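(* Let $(L,[\cdot,\cdot])$ be a Lie superalgebra over a field $k$, let $z\in Z(L)$ be homogeneous of degree $|z|=0$, and let $\alpha\in k$. Then the $k$-linear map $\phi^L_\alpha: L\otimes L\to L\otimes L$ determined on homogeneous elements $x,y\in L$ by $$\phi^L_\alpha(x\otimes y)=\alpha\,[x,y]\otimes z+(-1)^{|x||y|}\,y\otimes x$$ is a Yang-Baxter operator.
   Context: All tensor products are over the field $k$. A Lie superalgebra over $k$ is a $\mathbb{Z}_2$-graded (nonassociative) algebra $L=L_0\oplus L_1$ with a bilinear bracket $[\cdot,\cdot]$ such that, for all homogeneous $x,y,z$ (with $|x|\in\{0,1\}$ the degree of $x$), $[x,y]$ is homogeneous of degree $|x|+|y|$ modulo $2$, and $$[x,y]=-(-1)^{|x||y|}[y,x],$$ $$(-1)^{|z||x|}[x,[y,z]]+(-1)^{|x||y|}[y,[z,x]]+(-1)^{|y||z|}[z,[x,y]]=0.$$ The center is $Z(L)=\{z\in L : [z,x]=0\ \ \forall x\in L\}$. For a $k$-vector space $V$ and a linear map $R:V\otimes V\to V\otimes V$, put $R^{12}=R\otimes I$ and $R^{23}=I\otimes R$ on $V\otimes V\otimes V$, where $I$ is the identity of $V$. A Yang-Baxter operator is an invertible $k$-linear map $R:V\otimes V\to V\otimes V$ satisfying $R^{12}\circ R^{23}\circ R^{12}=R^{23}\circ R^{12}\circ R^{23}$. *)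

theory Defs
  imports "Jordan_Normal_Form.Missing_VectorSpace" "HOL-Algebra.QuotRing"
begin

text \<open>Vector spaces are the carrier-based ones of the locale \<open>vectorspace\<close>: a module record over a
  field record. Tensor products are not available for them, so they are constructed here. As usual
  for modules, the ring multiplication and unit of the constructed records are irrelevant.\<close>

subsection \<open>Tensor products\<close>

definition free_space :: "('k, 'r) ring_scheme \<Rightarrow> 'x set \<Rightarrow> ('k, 'x \<Rightarrow> 'k) module" where
  "free_space K X =
    \<lparr>carrier = {f. (\<forall>x\<in>X. f x \<in> carrier K) \<and> (\<forall>x. x \<notin> X \<longrightarrow> f x = \<zero>\<^bsub>K\<^esub>) \<and>
                   finite {x. f x \<noteq> \<zero>\<^bsub>K\<^esub>}},
     mult = undefined, one = undefined,
     zero = (\<lambda>x. \<zero>\<^bsub>K\<^esub>),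
     add = (\<lambda>f g x. f x \<oplus>\<^bsub>K\<^esub> g x),
     smult = (\<lambda>a f x. a \<otimes>\<^bsub>K\<^esub> f x)\<rparr>"

definition free_gen :: "('k, 'r) ring_scheme \<Rightarrow> 'x \<Rightarrow> 'x \<Rightarrow> 'k" where
  "free_gen K x = (\<lambda>y. if y = x then \<one>\<^bsub>K\<^esub> else \<zero>\<^bsub>K\<^esub>)"

text \<open>The scalar multiplication of cosets follows the pattern of \<open>rcoset_mult\<close>: the union below is
  the single coset of \<open>a \<odot> v\<close> for any representative \<open>v\<close>.\<close>

definition quot_space :: "('k, 'v, 'm) module_scheme \<Rightarrow> 'v set \<Rightarrow> ('k, 'v set) module" where
  "quot_space V W =
    \<lparr>carrier = a_rcosets\<^bsub>V\<^esub> W,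
     mult = undefined, one = undefined,
     zero = W,
     add = set_add V,
     smult = (\<lambda>a C. \<Union>v\<in>C. W +>\<^bsub>V\<^esub> (a \<odot>\<^bsub>V\<^esub> v))\<rparr>"

definition tensor_relations ::
  "('k, 'r) ring_scheme \<Rightarrow> ('k, 'v, 'm) module_scheme \<Rightarrow> ('k, 'w, 'n) module_scheme \<Rightarrow>
    ('v \<times> 'w \<Rightarrow> 'k) set" where
  "tensor_relations K V W =
    (let F = free_space K (carrier V \<times> carrier W); g = free_gen K in
      {g (v \<oplus>\<^bsub>V\<^esub> v', w) \<ominus>\<^bsub>F\<^esub> (g (v, w) \<oplus>\<^bsub>F\<^esub> g (v', w)) | v v' w.
         v \<in> carrier V \<and> v' \<in> carrier V \<and> w \<in> carrier W} \<union>
      {g (v, w \<oplus>\<^bsub>W\<^esub> w') \<ominus>\<^bsub>F\<^esub> (g (v, w) \<oplus>\<^bsub>F\<^esub> g (v, w')) | v w w'.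
         v \<in> carrier V \<and> w \<in> carrier W \<and> w' \<in> carrier W} \<union>
      {g (a \<odot>\<^bsub>V\<^esub> v, w) \<ominus>\<^bsub>F\<^esub> (a \<odot>\<^bsub>F\<^esub> g (v, w)) | a v w.
         a \<in> carrier K \<and> v \<in> carrier V \<and> w \<in> carrier W} \<union>
      {g (v, a \<odot>\<^bsub>W\<^esub> w) \<ominus>\<^bsub>F\<^esub> (a \<odot>\<^bsub>F\<^esub> g (v, w)) | a v w.
         a \<in> carrier K \<and> v \<in> carrier V \<and> w \<in> carrier W})"

definition tensor_null ::
  "('k, 'r) ring_scheme \<Rightarrow> ('k, 'v, 'm) module_scheme \<Rightarrow> ('k, 'w, 'n) module_scheme \<Rightarrow>
    ('v \<times> 'w \<Rightarrow> 'k) set" where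
  "tensor_null K V W =
    LinearCombinations.module.span K (free_space K (carrier V \<times> carrier W))
      (tensor_relations K V W)"

definition tensor_space ::
  "('k, 'r) ring_scheme \<Rightarrow> ('k, 'v, 'm) module_scheme \<Rightarrow> ('k, 'w, 'n) module_scheme \<Rightarrow>
    ('k, ('v \<times> 'w \<Rightarrow> 'k) set) module" where
  "tensor_space K V W =
    quot_space (free_space K (carrier V \<times> carrier W)) (tensor_null K V W)"

definition tensor ::
  "('k, 'r) ring_scheme \<Rightarrow> ('k, 'v, 'm) module_scheme \<Rightarrow> ('k, 'w, 'n) module_scheme \<Rightarrow>
    'v \<Rightarrow> 'w \<Rightarrow> ('v \<times> 'w \<Rightarrow> 'k) set" where
  "tensor K V W v w =
    tensor_null K V W +>\<^bsub>free_space K (carrier V \<times> carrier W)\<^esub> free_gen K (v, w)"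

text \<open>The linear map out of \<open>V \<otimes> W\<close> given by \<open>v \<otimes> w \<mapsto> b v w\<close>, meaningful when \<open>b\<close> is bilinear on
  the carriers.\<close>

definition tensor_lift ::
  "('k, 'r) ring_scheme \<Rightarrow> ('k, 'v, 'm) module_scheme \<Rightarrow> ('k, 'w, 'n) module_scheme \<Rightarrow>
    ('k, 'u, 'p) module_scheme \<Rightarrow> ('v \<Rightarrow> 'w \<Rightarrow> 'u) \<Rightarrow> ('v \<times> 'w \<Rightarrow> 'k) set \<Rightarrow> 'u" where
  "tensor_lift K V W U b =
    (THE h. h \<in> extensional (carrier (tensor_space K V W)) \<and>
            linear_map K (tensor_space K V W) U h \<and>
            (\<forall>v\<in>carrier V. \<forall>w\<in>carrier W. h (tensor K V W v w) = b v w))"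

definition tensor_map ::
  "('k, 'r) ring_scheme \<Rightarrow> ('k, 'v, 'm) module_scheme \<Rightarrow> ('k, 'w, 'n) module_scheme \<Rightarrow>
    ('k, 'v2, 'm2) module_scheme \<Rightarrow> ('k, 'w2, 'n2) module_scheme \<Rightarrow>
    ('v \<Rightarrow> 'v2) \<Rightarrow> ('w \<Rightarrow> 'w2) \<Rightarrow> ('v \<times> 'w \<Rightarrow> 'k) set \<Rightarrow> ('v2 \<times> 'w2 \<Rightarrow> 'k) set" where
  "tensor_map K V W V' W' f g =
    tensor_lift K V W (tensor_space K V' W') (\<lambda>v w. tensor K V' W' (f v) (g w))"

text \<open>The canonical isomorphism \<open>(U \<otimes> V) \<otimes> W \<rightarrow> U \<otimes> (V \<otimes> W)\<close>.\<close>

definition tensor_assoc ::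
  "('k, 'r) ring_scheme \<Rightarrow> ('k, 'u, 'l) module_scheme \<Rightarrow> ('k, 'v, 'm) module_scheme \<Rightarrow>
    ('k, 'w, 'n) module_scheme \<Rightarrow>
    (('u \<times> 'v \<Rightarrow> 'k) set \<times> 'w \<Rightarrow> 'k) set \<Rightarrow> ('u \<times> ('v \<times> 'w \<Rightarrow> 'k) set \<Rightarrow> 'k) set" where
  "tensor_assoc K U V W =
    (let T = tensor_space K U (tensor_space K V W) in
      tensor_lift K (tensor_space K U V) W T
        (\<lambda>t w. tensor_lift K U V T
          (\<lambda>u v. tensor K U (tensor_space K V W) u (tensor K V W v w)) t))"


subsection \<open>Yang-Baxter operators\<close>

text \<open>The triple tensor product \<open>V \<otimes> V \<otimes> V\<close> is \<open>(V \<otimes> V) \<otimes> V\<close>; the map \<open>I \<otimes> R\<close> on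
  \<open>V \<otimes> (V \<otimes> V)\<close> is transported to it along the associativity isomorphism.\<close>

definition tensor_cube ::
  "('k, 'r) ring_scheme \<Rightarrow> ('k, 'v, 'm) module_scheme \<Rightarrow>
    ('k, (('v \<times> 'v \<Rightarrow> 'k) set \<times> 'v \<Rightarrow> 'k) set) module" where
  "tensor_cube K V = tensor_space K (tensor_space K V V) V"

definition R12 ::
  "('k, 'r) ring_scheme \<Rightarrow> ('k, 'v, 'm) module_scheme \<Rightarrow>
    (('v \<times> 'v \<Rightarrow> 'k) set \<Rightarrow> ('v \<times> 'v \<Rightarrow> 'k) set) \<Rightarrow>
    (('v \<times> 'v \<Rightarrow> 'k) set \<times> 'v \<Rightarrow> 'k) set \<Rightarrow> (('v \<times> 'v \<Rightarrow> 'k) set \<times> 'v \<Rightarrow> 'k) set" where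
  "R12 K V R = tensor_map K (tensor_space K V V) V (tensor_space K V V) V R (\<lambda>v. v)"

definition R23 ::
  "('k, 'r) ring_scheme \<Rightarrow> ('k, 'v, 'm) module_scheme \<Rightarrow>
    (('v \<times> 'v \<Rightarrow> 'k) set \<Rightarrow> ('v \<times> 'v \<Rightarrow> 'k) set) \<Rightarrow>
    (('v \<times> 'v \<Rightarrow> 'k) set \<times> 'v \<Rightarrow> 'k) set \<Rightarrow> (('v \<times> 'v \<Rightarrow> 'k) set \<times> 'v \<Rightarrow> 'k) set" where
  "R23 K V R =
    inv_into (carrier (tensor_cube K V)) (tensor_assoc K V V V) \<circ>
    tensor_map K V (tensor_space K V V) V (tensor_space K V V) (\<lambda>v. v) R \<circ>
    tensor_assoc K V V V"

definition yang_baxter_operator ::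
  "('k, 'r) ring_scheme \<Rightarrow> ('k, 'v, 'm) module_scheme \<Rightarrow>
    (('v \<times> 'v \<Rightarrow> 'k) set \<Rightarrow> ('v \<times> 'v \<Rightarrow> 'k) set) \<Rightarrow> bool" where
  "yang_baxter_operator K V R \<longleftrightarrow>
    linear_map K (tensor_space K V V) (tensor_space K V V) R \<and>
    bij_betw R (carrier (tensor_space K V V)) (carrier (tensor_space K V V)) \<and>
    (\<forall>t\<in>carrier (tensor_cube K V).
      (R12 K V R \<circ> R23 K V R \<circ> R12 K V R) t = (R23 K V R \<circ> R12 K V R \<circ> R23 K V R) t)"


subsection \<open>Lie superalgebras\<close>

definition koszul_sign :: "('k, 'r) ring_scheme \<Rightarrow> nat \<Rightarrow> nat \<Rightarrow> 'k" where
  "koszul_sign K i j = (\<ominus>\<^bsub>K\<^esub> \<one>\<^bsub>K\<^esub>) [^]\<^bsub>K\<^esub> (i * j)"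

text \<open>\<open>G i\<close> is the homogeneous part of degree \<open>i\<close>; only \<open>G 0\<close> and \<open>G 1\<close> are used. In
  characteristic 2 and 3 no further identities are imposed.\<close>

locale lie_superalgebra = vectorspace K L
  for K :: "('k, 'r) ring_scheme" and L :: "('k, 'v, 'm) module_scheme" +
  fixes G :: "nat \<Rightarrow> 'v set"
    and bracket :: "'v \<Rightarrow> 'v \<Rightarrow> 'v"
  assumes grade_subspace: "i \<in> {0, 1} \<Longrightarrow> subspace K (G i) L"
    and grade_sum: "carrier L = submodule_sum (G 0) (G 1)"
    and grade_direct: "G 0 \<inter> G 1 = {\<zero>\<^bsub>L\<^esub>}"
    and bracket_linear_left: "y \<in> carrier L \<Longrightarrow> linear_map K L L (\<lambda>x. bracket x y)"
    and bracket_linear_right: "x \<in> carrier L \<Longrightarrow> linear_map K L L (\<lambda>y. bracket x y)"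
    and bracket_grade:
      "\<lbrakk>i \<in> {0, 1}; j \<in> {0, 1}; x \<in> G i; y \<in> G j\<rbrakk> \<Longrightarrow> bracket x y \<in> G ((i + j) mod 2)"
    and super_skew:
      "\<lbrakk>i \<in> {0, 1}; j \<in> {0, 1}; x \<in> G i; y \<in> G j\<rbrakk> \<Longrightarrow>
        bracket x y = \<ominus>\<^bsub>L\<^esub> (koszul_sign K i j \<odot>\<^bsub>L\<^esub> bracket y x)"
    and super_jacobi:
      "\<lbrakk>i \<in> {0, 1}; j \<in> {0, 1}; l \<in> {0, 1}; x \<in> G i; y \<in> G j; z \<in> G l\<rbrakk> \<Longrightarrow>
        koszul_sign K l i \<odot>\<^bsub>L\<^esub> bracket x (bracket y z) \<oplus>\<^bsub>L\<^esub>
        koszul_sign K i j \<odot>\<^bsub>L\<^esub> bracket y (bracket z x) \<oplus>\<^bsub>L\<^esub>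
        koszul_sign K j l \<odot>\<^bsub>L\<^esub> bracket z (bracket x y) = \<zero>\<^bsub>L\<^esub>"

definition lie_center :: "('k, 'v, 'm) module_scheme \<Rightarrow> ('v \<Rightarrow> 'v \<Rightarrow> 'v) \<Rightarrow> 'v set" where
  "lie_center L bracket = {z \<in> carrier L. \<forall>x\<in>carrier L. bracket z x = \<zero>\<^bsub>L\<^esub>}"

definition is_phi ::
  "('k, 'r) ring_scheme \<Rightarrow> ('k, 'v, 'm) module_scheme \<Rightarrow> (nat \<Rightarrow> 'v set) \<Rightarrow> ('v \<Rightarrow> 'v \<Rightarrow> 'v) \<Rightarrow>
    'v \<Rightarrow> 'k \<Rightarrow> (('v \<times> 'v \<Rightarrow> 'k) set \<Rightarrow> ('v \<times> 'v \<Rightarrow> 'k) set) \<Rightarrow> bool" where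
  "is_phi K L G bracket z \<alpha> \<phi> \<longleftrightarrow>
    linear_map K (tensor_space K L L) (tensor_space K L L) \<phi> \<and>
    (\<forall>i\<in>{0, 1}. \<forall>j\<in>{0, 1}. \<forall>x\<in>G i. \<forall>y\<in>G j.
      \<phi> (tensor K L L x y) =
        \<alpha> \<odot>\<^bsub>tensor_space K L L\<^esub> tensor K L L (bracket x y) z \<oplus>\<^bsub>tensor_space K L L\<^esub>
        koszul_sign K i j \<odot>\<^bsub>tensor_space K L L\<^esub> tensor K L L y x)"

end

theory Submission
  imports Defs
begin

text \<open>
  Write \<open>\<epsilon>\<^sub>x\<^sub>y\<close> for the Koszul sign of homogeneous \<open>x\<close>, \<open>y\<close>. Uniqueness, invertibility
  and the braid relation are equalities of linear maps on \<open>L \<otimes> L\<close> or on \<open>L \<otimes> L \<otimes> L\<close>. Such an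
  equality can be checked on tensors of homogeneous elements
  (\<open>linear_map_graded_tensor_eqI\<close>, \<open>linear_map_graded_cube_eqI\<close>), where it becomes a short
  computation with the super Jacobi identity.

  Existence and uniqueness (\<open>phi_exists_unique\<close>). Homogeneous tensors span \<open>L \<otimes> L\<close>, which gives
  uniqueness. For existence, the bilinear map \<open>(x, y) \<mapsto> \<alpha> [x, y] \<otimes> z\<close> is lifted to \<open>L \<otimes> L\<close>, and
  the signed flip \<open>x \<otimes> y \<mapsto> \<epsilon>\<^sub>x\<^sub>y y \<otimes> x\<close> is obtained from a bilinear formula in the even and odd parts
  of \<open>x\<close> and \<open>y\<close> (\<open>super_swap\<close>).

  Invertibility (\<open>phi_bij\<close>). The inverse is \<open>x \<otimes> y \<mapsto> \<alpha> z \<otimes> [x, y] + \<epsilon>\<^sub>x\<^sub>y y \<otimes> x\<close>. Centrality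
  kills all brackets with \<open>z\<close>, and super skew symmetry makes the two remaining terms with \<open>\<alpha>\<close>
  cancel.

  Braid relation (\<open>phi_braid\<close>). For homogeneous \<open>x\<close>, \<open>y\<close>, \<open>w\<close> both sides expand into tensors with
  at most two factors \<open>z\<close>. The terms with at most one \<open>z\<close> agree because \<open>\<epsilon>\<close> is multiplicative
  in the degrees. The terms ending in \<open>z \<otimes> z\<close> have the coefficients
  \<open>\<alpha>\<^sup>2 ([[x, y], w] + \<epsilon>\<^sub>x\<^sub>y [y, [x, w]])\<close> and \<open>\<alpha>\<^sup>2 [x, [y, w]]\<close>, which are equal by the super Jacobi
  identity in its Leibniz form (\<open>super_leibniz\<close>).

  The larger part of the text supplies what these computations rest on: the universal property of
  the tensor product, built as a quotient of a free space (\<open>linear_map_tensor_lift\<close>,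
  \<open>tensor_lift_tensor\<close>), and the bijectivity of the associativity map (\<open>inv_into_assoc\<close>), which
  makes \<open>R23\<close> computable on pure tensors (\<open>R23_tensor\<close>).
\<close>

section \<open>Linear maps\<close>

lemma linear_mapI:
  assumes "vectorspace K V" "vectorspace K W"
    and "\<And>v. v \<in> carrier V \<Longrightarrow> f v \<in> carrier W"
    and "\<And>v v'. v \<in> carrier V \<Longrightarrow> v' \<in> carrier V \<Longrightarrow> f (v \<oplus>\<^bsub>V\<^esub> v') = f v \<oplus>\<^bsub>W\<^esub> f v'"
    and "\<And>a v. a \<in> carrier K \<Longrightarrow> v \<in> carrier V \<Longrightarrow> f (a \<odot>\<^bsub>V\<^esub> v) = a \<odot>\<^bsub>W\<^esub> f v"
  shows "linear_map K V W f"
  using assms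
  by (auto simp: linear_map_def mod_hom_def mod_hom_axioms_def module_hom_def vectorspace_def)

lemma linear_mapD:
  assumes "linear_map K V W f"
  shows linear_map_dom: "vectorspace K V"
    and linear_map_cod: "vectorspace K W"
    and linear_map_closed: "v \<in> carrier V \<Longrightarrow> f v \<in> carrier W"
    and linear_map_add: "v \<in> carrier V \<Longrightarrow> v' \<in> carrier V \<Longrightarrow> f (v \<oplus>\<^bsub>V\<^esub> v') = f v \<oplus>\<^bsub>W\<^esub> f v'"
    and linear_map_smult: "a \<in> carrier K \<Longrightarrow> v \<in> carrier V \<Longrightarrow> f (a \<odot>\<^bsub>V\<^esub> v) = a \<odot>\<^bsub>W\<^esub> f v"
    and linear_map_zero: "f \<zero>\<^bsub>V\<^esub> = \<zero>\<^bsub>W\<^esub>"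
proof -
  interpret linear_map K V W f by fact
  show "vectorspace K V" "vectorspace K W" by unfold_locales
  show "v \<in> carrier V \<Longrightarrow> f v \<in> carrier W"
    "v \<in> carrier V \<Longrightarrow> v' \<in> carrier V \<Longrightarrow> f (v \<oplus>\<^bsub>V\<^esub> v') = f v \<oplus>\<^bsub>W\<^esub> f v'"
    "a \<in> carrier K \<Longrightarrow> v \<in> carrier V \<Longrightarrow> f (a \<odot>\<^bsub>V\<^esub> v) = a \<odot>\<^bsub>W\<^esub> f v"
    "f \<zero>\<^bsub>V\<^esub> = \<zero>\<^bsub>W\<^esub>"
    by simp_all
qed

lemma linear_map_comp:
  assumes "linear_map K U V f" "linear_map K V W g"
  shows "linear_map K U W (\<lambda>x. g (f x))"
  by (rule linear_mapI)
    (simp_all add: linear_mapD[OF assms(1)] linear_mapD[OF assms(2)])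

lemma linear_map_id: "vectorspace K V \<Longrightarrow> linear_map K V V (\<lambda>x. x)"
  by (rule linear_mapI) simp_all

lemma linear_map_sum:
  assumes "linear_map K V W f" "linear_map K V W g"
  shows "linear_map K V W (\<lambda>x. f x \<oplus>\<^bsub>W\<^esub> g x)"
proof -
  interpret W: vectorspace K W by (rule linear_map_cod[OF assms(1)])
  show ?thesis
    by (rule linear_mapI)
      (simp_all add: linear_mapD[OF assms(1)] linear_mapD[OF assms(2)] W.smult_r_distr W.M.a_ac
        W.vectorspace_axioms)
qed

lemma linear_map_scale:
  assumes "linear_map K V W f" "a \<in> carrier K"
  shows "linear_map K V W (\<lambda>x. a \<odot>\<^bsub>W\<^esub> f x)"
proof -
  interpret W: vectorspace K W by (rule linear_map_cod[OF assms(1)])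
  show ?thesis
    by (rule linear_mapI)
      (simp_all add: assms(2) linear_mapD[OF assms(1)] W.smult_r_distr W.smult_assoc_simp
        W.R.m_comm W.vectorspace_axioms)
qed

lemma linear_map_restrict:
  assumes "linear_map K V W f"
  shows "linear_map K V W (restrict f (carrier V))"
proof -
  interpret V: vectorspace K V by (rule linear_map_dom[OF assms])
  show ?thesis
    by (rule linear_mapI) (simp_all add: linear_mapD[OF assms])
qed

lemma linear_map_cong:
  assumes "linear_map K V W f" "\<And>v. v \<in> carrier V \<Longrightarrow> g v = f v"
  shows "linear_map K V W g"
proof -
  interpret V: vectorspace K V by (rule linear_map_dom[OF assms(1)])
  show ?thesis
    by (rule linear_mapI) (simp_all add: linear_mapD[OF assms(1)] assms(2))
qed

section \<open>Free spaces\<close>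

lemma free_space_simps:
  "zero (free_space K X) = (\<lambda>x. \<zero>\<^bsub>K\<^esub>)"
  "f \<oplus>\<^bsub>free_space K X\<^esub> g = (\<lambda>x. f x \<oplus>\<^bsub>K\<^esub> g x)"
  "a \<odot>\<^bsub>free_space K X\<^esub> f = (\<lambda>x. a \<otimes>\<^bsub>K\<^esub> f x)"
  by (simp_all add: free_space_def)

lemma free_space_carrier:
  "f \<in> carrier (free_space K X) \<longleftrightarrow>
    (\<forall>x\<in>X. f x \<in> carrier K) \<and> (\<forall>x. x \<notin> X \<longrightarrow> f x = \<zero>\<^bsub>K\<^esub>) \<and> finite {x. f x \<noteq> \<zero>\<^bsub>K\<^esub>}"
  by (simp add: free_space_def)

lemma vectorspace_free_space:
  assumes "field K"
  shows "vectorspace K (free_space K X)"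
proof -
  interpret K: field K by fact
  let ?F = "free_space K X"
  have app: "f x \<in> carrier K" if "f \<in> carrier ?F" for f x
    using that by (cases "x \<in> X") (simp_all add: free_space_carrier)
  have add: "f \<oplus>\<^bsub>?F\<^esub> g \<in> carrier ?F" if "f \<in> carrier ?F" "g \<in> carrier ?F" for f g
  proof -
    have "{x. f x \<oplus>\<^bsub>K\<^esub> g x \<noteq> \<zero>\<^bsub>K\<^esub>} \<subseteq> {x. f x \<noteq> \<zero>\<^bsub>K\<^esub>} \<union> {x. g x \<noteq> \<zero>\<^bsub>K\<^esub>}" by auto
    with that show ?thesis
      by (simp add: free_space_carrier free_space_simps) (meson finite_UnI finite_subset)
  qed
  have smult: "a \<odot>\<^bsub>?F\<^esub> f \<in> carrier ?F" if "a \<in> carrier K" "f \<in> carrier ?F" for a f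
  proof -
    have "{x. a \<otimes>\<^bsub>K\<^esub> f x \<noteq> \<zero>\<^bsub>K\<^esub>} \<subseteq> {x. f x \<noteq> \<zero>\<^bsub>K\<^esub>}" using that by auto
    with that show ?thesis
      by (simp add: free_space_carrier free_space_simps) (meson finite_subset)
  qed
  have neg: "\<exists>g\<in>carrier ?F. f \<oplus>\<^bsub>?F\<^esub> g = \<zero>\<^bsub>?F\<^esub>" if f: "f \<in> carrier ?F" for f
  proof
    show "(\<ominus>\<^bsub>K\<^esub> \<one>\<^bsub>K\<^esub>) \<odot>\<^bsub>?F\<^esub> f \<in> carrier ?F" using smult f by simp
    show "f \<oplus>\<^bsub>?F\<^esub> ((\<ominus>\<^bsub>K\<^esub> \<one>\<^bsub>K\<^esub>) \<odot>\<^bsub>?F\<^esub> f) = \<zero>\<^bsub>?F\<^esub>"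
      using app[OF f] by (auto simp: free_space_simps K.l_minus K.r_neg)
  qed
  show ?thesis
  proof (rule vs_criteria)
    show "field K" by fact
    show "\<zero>\<^bsub>?F\<^esub> \<in> carrier ?F" by (simp add: free_space_carrier free_space_simps)
  qed (use add smult neg in \<open>auto simp: free_space_simps app K.a_ac K.m_assoc K.l_distr K.r_distr\<close>)
qed

lemma free_gen_closed:
  assumes "field K" "x \<in> X"
  shows "free_gen K x \<in> carrier (free_space K X)"
proof -
  interpret K: field K by fact
  have "{y. y = x \<and> \<one>\<^bsub>K\<^esub> \<noteq> \<zero>\<^bsub>K\<^esub>} = {x}" by auto
  then show ?thesis using assms(2) by (auto simp: free_space_carrier free_gen_def)
qed

text \<open>Removing one point from the support of \<open>f\<close> splits off a multiple of a generator, so the induction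
is on the size of the support.\<close>

lemma free_space_induct [consumes 2, case_names zero step]:
  assumes "field K" and f: "f \<in> carrier (free_space K X)"
    and zero: "P \<zero>\<^bsub>free_space K X\<^esub>"
    and step: "\<And>a x f. \<lbrakk>a \<in> carrier K; x \<in> X; f \<in> carrier (free_space K X); P f\<rbrakk>
      \<Longrightarrow> P (a \<odot>\<^bsub>free_space K X\<^esub> free_gen K x \<oplus>\<^bsub>free_space K X\<^esub> f)"
  shows "P f"
proof -
  interpret K: field K by fact
  let ?F = "free_space K X"
  have "finite S \<Longrightarrow> f \<in> carrier ?F \<Longrightarrow> {x. f x \<noteq> \<zero>\<^bsub>K\<^esub>} \<subseteq> S \<Longrightarrow> P f" for S
  proof (induction S arbitrary: f rule: finite_induct)
    case empty
    then have "f = \<zero>\<^bsub>?F\<^esub>" by (auto simp: free_space_simps)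
    with zero show ?case by simp
  next
    case (insert x S)
    show ?case
    proof (cases "f x = \<zero>\<^bsub>K\<^esub>")
      case True
      then have "{x. f x \<noteq> \<zero>\<^bsub>K\<^esub>} \<subseteq> S" using insert.prems by auto
      then show ?thesis using insert by blast
    next
      case False
      then have x: "x \<in> X" using insert.prems by (auto simp: free_space_carrier)
      define g where "g = f(x := \<zero>\<^bsub>K\<^esub>)"
      have supp: "{y. g y \<noteq> \<zero>\<^bsub>K\<^esub>} \<subseteq> S" using insert.prems by (auto simp: g_def)
      then have g: "g \<in> carrier ?F"
        using insert.prems finite_subset[OF supp insert.hyps(1)]
        by (auto simp: free_space_carrier g_def)
      have fc: "f y \<in> carrier K" for y
        using insert.prems(1) by (cases "y \<in> X") (simp_all add: free_space_carrier)
      have "f = f x \<odot>\<^bsub>?F\<^esub> free_gen K x \<oplus>\<^bsub>?F\<^esub> g"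
        by (auto simp: free_space_simps free_gen_def g_def fc)
      moreover have "P (f x \<odot>\<^bsub>?F\<^esub> free_gen K x \<oplus>\<^bsub>?F\<^esub> g)"
        by (rule step) (use fc x g insert.IH[OF g supp] in auto)
      ultimately show ?thesis by simp
    qed
  qed
  with f show ?thesis by (auto simp: free_space_carrier)
qed

text \<open>The sum runs over the support of \<open>f\<close>, which is finite on the carrier of the free space.\<close>

definition free_lift ::
  "('k, 'r) ring_scheme \<Rightarrow> ('k, 'u, 'p) module_scheme \<Rightarrow> ('x \<Rightarrow> 'u) \<Rightarrow> ('x \<Rightarrow> 'k) \<Rightarrow> 'u" where
  "free_lift K U b f = (\<Oplus>\<^bsub>U\<^esub>x\<in>{x. f x \<noteq> \<zero>\<^bsub>K\<^esub>}. f x \<odot>\<^bsub>U\<^esub> b x)"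

text \<open>Outside the support the summands vanish. Enlarging the index set lets two functions with different
supports be summed over a common one, which is how linearity is proved below.\<close>

lemma free_lift_superset:
  assumes "vectorspace K U" "\<And>x. x \<in> X \<Longrightarrow> b x \<in> carrier U"
    and "f \<in> carrier (free_space K X)"
    and "finite A" "{x. f x \<noteq> \<zero>\<^bsub>K\<^esub>} \<subseteq> A" "A \<subseteq> X"
  shows "free_lift K U b f = (\<Oplus>\<^bsub>U\<^esub>x\<in>A. f x \<odot>\<^bsub>U\<^esub> b x)"
proof -
  interpret U: vectorspace K U by fact
  show ?thesis unfolding free_lift_def
    by (rule U.M.add.finprod_mono_neutral_cong_left)
      (use assms in \<open>auto simp: free_space_carrier subset_iff\<close>)
qed

lemma
  assumes U: "vectorspace K U" and b: "\<And>x. x \<in> X \<Longrightarrow> b x \<in> carrier U"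
  shows linear_map_free_lift: "linear_map K (free_space K X) U (free_lift K U b)"
    and free_lift_gen: "x \<in> X \<Longrightarrow> free_lift K U b (free_gen K x) = b x"
proof -
  interpret U: vectorspace K U by fact
  let ?F = "free_space K X"
  interpret F: vectorspace K ?F by (rule vectorspace_free_space) unfold_locales
  have coeff: "f x \<in> carrier K" if "f \<in> carrier ?F" for f x
    using that by (cases "x \<in> X") (simp_all add: free_space_carrier)
  have supp: "finite {x. f x \<noteq> \<zero>\<^bsub>K\<^esub>}" "{x. f x \<noteq> \<zero>\<^bsub>K\<^esub>} \<subseteq> X" if "f \<in> carrier ?F" for f
    using that by (auto simp: free_space_carrier)
  have eq: "free_lift K U b f = (\<Oplus>\<^bsub>U\<^esub>x\<in>A. f x \<odot>\<^bsub>U\<^esub> b x)"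
    if "f \<in> carrier ?F" "finite A" "{x. f x \<noteq> \<zero>\<^bsub>K\<^esub>} \<subseteq> A" "A \<subseteq> X" for f A
    using U b that by (rule free_lift_superset)
  show "linear_map K ?F U (free_lift K U b)"
  proof (rule linear_mapI)
    show "free_lift K U b f \<in> carrier U" if "f \<in> carrier ?F" for f
      unfolding free_lift_def using supp[OF that] coeff[OF that] b
      by (intro U.M.finsum_closed) auto
    show "free_lift K U b (f \<oplus>\<^bsub>?F\<^esub> g) = free_lift K U b f \<oplus>\<^bsub>U\<^esub> free_lift K U b g"
      if f: "f \<in> carrier ?F" and g: "g \<in> carrier ?F" for f g
    proof -
      let ?A = "{x. f x \<noteq> \<zero>\<^bsub>K\<^esub>} \<union> {x. g x \<noteq> \<zero>\<^bsub>K\<^esub>}"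
      have A: "finite ?A" "?A \<subseteq> X" using supp[OF f] supp[OF g] by auto
      have bA: "b x \<in> carrier U" if "x \<in> ?A" for x using b A(2) that by blast
      have summand: "h x \<odot>\<^bsub>U\<^esub> b x \<in> carrier U" if "h \<in> carrier ?F" "x \<in> ?A" for h x
        using coeff[OF that(1)] bA[OF that(2)] by (rule U.smult_closed)
      have "free_lift K U b (f \<oplus>\<^bsub>?F\<^esub> g) = (\<Oplus>\<^bsub>U\<^esub>x\<in>?A. (f \<oplus>\<^bsub>?F\<^esub> g) x \<odot>\<^bsub>U\<^esub> b x)"
        by (rule eq[OF F.M.a_closed[OF f g] A(1) _ A(2)]) (auto simp: free_space_simps(2))
      also have "\<dots> = (\<Oplus>\<^bsub>U\<^esub>x\<in>?A. f x \<odot>\<^bsub>U\<^esub> b x \<oplus>\<^bsub>U\<^esub> g x \<odot>\<^bsub>U\<^esub> b x)"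
        by (rule U.M.finsum_cong'[OF refl funcsetI])
          (rule U.M.a_closed[OF summand[OF f] summand[OF g]],
            simp_all only: free_space_simps(2) U.smult_l_distr coeff[OF f] coeff[OF g] bA)
      also have "\<dots> = (\<Oplus>\<^bsub>U\<^esub>x\<in>?A. f x \<odot>\<^bsub>U\<^esub> b x) \<oplus>\<^bsub>U\<^esub> (\<Oplus>\<^bsub>U\<^esub>x\<in>?A. g x \<odot>\<^bsub>U\<^esub> b x)"
        by (rule U.M.finsum_addf[OF funcsetI funcsetI]) (rule summand[OF f] summand[OF g], assumption)+
      also have "\<dots> = free_lift K U b f \<oplus>\<^bsub>U\<^esub> free_lift K U b g"
        
        using eq[OF f A(1) _ A(2)] eq[OF g A(1) _ A(2)] by auto
      finally show ?thesis .
    qed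
    show "free_lift K U b (a \<odot>\<^bsub>?F\<^esub> f) = a \<odot>\<^bsub>U\<^esub> free_lift K U b f"
      if a: "a \<in> carrier K" and f: "f \<in> carrier ?F" for a f
    proof -
      let ?A = "{x. f x \<noteq> \<zero>\<^bsub>K\<^esub>}"
      note A = supp[OF f]
      have bA: "b x \<in> carrier U" if "x \<in> ?A" for x using b A(2) that by blast
      have summand: "f x \<odot>\<^bsub>U\<^esub> b x \<in> carrier U" if "x \<in> ?A" for x
        using coeff[OF f] bA[OF that] by (rule U.smult_closed)
      have "free_lift K U b (a \<odot>\<^bsub>?F\<^esub> f) = (\<Oplus>\<^bsub>U\<^esub>x\<in>?A. (a \<odot>\<^bsub>?F\<^esub> f) x \<odot>\<^bsub>U\<^esub> b x)"
        by (rule eq[OF F.smult_closed[OF a f] A(1) _ A(2)]) (use a in \<open>auto simp: free_space_simps(3)\<close>)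
      also have "\<dots> = (\<Oplus>\<^bsub>U\<^esub>x\<in>?A. a \<odot>\<^bsub>U\<^esub> (f x \<odot>\<^bsub>U\<^esub> b x))"
        by (rule U.M.finsum_cong'[OF refl funcsetI])
          (rule U.smult_closed[OF a summand],
            simp_all only: free_space_simps(3) U.smult_assoc1 a coeff[OF f] bA)
      also have "\<dots> = a \<odot>\<^bsub>U\<^esub> free_lift K U b f"
        unfolding free_lift_def
        by (rule U.finsum_smult_ldistr[symmetric, OF A(1) a funcsetI]) (rule summand)
      finally show ?thesis .
    qed
  qed (rule F.vectorspace_axioms U.vectorspace_axioms)+
  show "free_lift K U b (free_gen K x) = b x" if x: "x \<in> X"
  proof -
    have "free_lift K U b (free_gen K x) = (\<Oplus>\<^bsub>U\<^esub>y\<in>{x}. free_gen K x y \<odot>\<^bsub>U\<^esub> b y)"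
      using free_gen_closed[OF U.field_axioms x] x by (intro eq) (simp_all, auto simp: free_gen_def)
    then show ?thesis using b[OF x] by (simp add: free_gen_def)
  qed
qed

section \<open>Quotient spaces\<close>

text \<open>Cosets of a subspace are computed on representatives. For scalar multiplication this says that the
union in the definition of \<open>quot_space\<close> is a union of equal cosets: if \<open>u = w + v\<close> with \<open>w\<close> in
\<open>W\<close>, then \<open>a u - a v = a w\<close> lies in \<open>W\<close> again.\<close>

lemma
  assumes "subspace K W V"
  shows quot_space_carrier: "carrier (quot_space V W) = {W +>\<^bsub>V\<^esub> v | v. v \<in> carrier V}"
    and quot_space_add: "\<And>v v'. v \<in> carrier V \<Longrightarrow> v' \<in> carrier V \<Longrightarrow>
      (W +>\<^bsub>V\<^esub> v) \<oplus>\<^bsub>quot_space V W\<^esub> (W +>\<^bsub>V\<^esub> v') = W +>\<^bsub>V\<^esub> (v \<oplus>\<^bsub>V\<^esub> v')"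
    and quot_space_smult: "\<And>a v. a \<in> carrier K \<Longrightarrow> v \<in> carrier V \<Longrightarrow>
      a \<odot>\<^bsub>quot_space V W\<^esub> (W +>\<^bsub>V\<^esub> v) = W +>\<^bsub>V\<^esub> (a \<odot>\<^bsub>V\<^esub> v)"
    and quot_space_zero: "\<zero>\<^bsub>quot_space V W\<^esub> = W +>\<^bsub>V\<^esub> \<zero>\<^bsub>V\<^esub>"
    and coset_eqI: "\<And>v v'. v \<in> carrier V \<Longrightarrow> v' \<in> carrier V \<Longrightarrow> v \<ominus>\<^bsub>V\<^esub> v' \<in> W \<Longrightarrow>
      W +>\<^bsub>V\<^esub> v = W +>\<^bsub>V\<^esub> v'"
    and coset_eqD: "\<And>v v'. v \<in> carrier V \<Longrightarrow> v' \<in> carrier V \<Longrightarrow> 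
      W +>\<^bsub>V\<^esub> v = W +>\<^bsub>V\<^esub> v' \<Longrightarrow> v \<ominus>\<^bsub>V\<^esub> v' \<in> W"
proof -
  interpret V: vectorspace K V using assms by (simp add: subspace_def)
  interpret W: submodule K W V using assms by (simp add: subspace_def)
  have neg: "\<ominus>\<^bsub>V\<^esub> w \<in> W" if "w \<in> W" for w
    using W.smult_closed[of "\<ominus>\<^bsub>K\<^esub> \<one>\<^bsub>K\<^esub>" w] that W.subset
    by (metis V.R.a_inv_closed V.R.one_closed V.smult_minus_1 subsetD)
  have sub: "subgroup W (add_monoid V)"
    by unfold_locales (use W.subset neg in \<open>auto simp: a_inv_def\<close>)
  interpret A: abelian_subgroup W V
    by (rule abelian_subgroupI3) (use sub V.M.abelian_group_axioms in \<open>auto intro: additive_subgroup.intro\<close>)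
  show carr: "carrier (quot_space V W) = {W +>\<^bsub>V\<^esub> v | v. v \<in> carrier V}"
    by (auto simp: quot_space_def A_RCOSETS_def')
  show "(W +>\<^bsub>V\<^esub> v) \<oplus>\<^bsub>quot_space V W\<^esub> (W +>\<^bsub>V\<^esub> v') = W +>\<^bsub>V\<^esub> (v \<oplus>\<^bsub>V\<^esub> v')"
    if "v \<in> carrier V" "v' \<in> carrier V" for v v'
    using A.a_rcos_sum[OF that] by (simp add: quot_space_def)
  show "\<zero>\<^bsub>quot_space V W\<^esub> = W +>\<^bsub>V\<^esub> \<zero>\<^bsub>V\<^esub>"
    using W.subset by (simp add: quot_space_def)
  have self: "v \<in> W +>\<^bsub>V\<^esub> v" if "v \<in> carrier V" for v
    using that by (rule A.a_rcos_self)
  show eqI: "W +>\<^bsub>V\<^esub> v = W +>\<^bsub>V\<^esub> v'" if "v \<in> carrier V" "v' \<in> carrier V" "v \<ominus>\<^bsub>V\<^esub> v' \<in> W" for v v'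
    using that V.M.a_coset_add_inv1[of W v v'] V.M.a_coset_join2[OF _ sub] W.subset
    by (simp add: a_minus_def)
  show "v \<ominus>\<^bsub>V\<^esub> v' \<in> W" if "v \<in> carrier V" "v' \<in> carrier V" "W +>\<^bsub>V\<^esub> v = W +>\<^bsub>V\<^esub> v'" for v v'
    using that V.M.a_coset_add_inv2[of W v v'] V.M.a_coset_join1[OF _ _ sub] W.subset
    by (simp add: a_minus_def)
  show "a \<odot>\<^bsub>quot_space V W\<^esub> (W +>\<^bsub>V\<^esub> v) = W +>\<^bsub>V\<^esub> (a \<odot>\<^bsub>V\<^esub> v)"
    if a: "a \<in> carrier K" and v: "v \<in> carrier V" for a v
  proof -
    have "W +>\<^bsub>V\<^esub> (a \<odot>\<^bsub>V\<^esub> u) = W +>\<^bsub>V\<^esub> (a \<odot>\<^bsub>V\<^esub> v)" if u: "u \<in> W +>\<^bsub>V\<^esub> v" for u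
    proof -
      obtain w where w: "w \<in> W" "u = w \<oplus>\<^bsub>V\<^esub> v" using u by (auto simp: a_r_coset_def')
      then have wc: "w \<in> carrier V" using W.subset by auto
      have "(a \<odot>\<^bsub>V\<^esub> u) \<ominus>\<^bsub>V\<^esub> (a \<odot>\<^bsub>V\<^esub> v) = a \<odot>\<^bsub>V\<^esub> w"
        using a v wc by (simp add: w V.smult_r_distr a_minus_def V.M.a_assoc V.M.r_neg)
      then show ?thesis using a v w wc by (intro eqI) auto
    qed
    then have "(\<Union>u\<in>W +>\<^bsub>V\<^esub> v. W +>\<^bsub>V\<^esub> (a \<odot>\<^bsub>V\<^esub> u)) = (\<Union>u\<in>W +>\<^bsub>V\<^esub> v. W +>\<^bsub>V\<^esub> (a \<odot>\<^bsub>V\<^esub> v))"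
      by (rule SUP_cong[OF refl])
    also have "\<dots> = W +>\<^bsub>V\<^esub> (a \<odot>\<^bsub>V\<^esub> v)" using self[OF v] by blast
    finally show ?thesis by (simp add: quot_space_def)
  qed
qed

lemma vectorspace_quot_space:
  assumes S: "subspace K W V"
  shows "vectorspace K (quot_space V W)"
proof -
  interpret V: vectorspace K V using assms by (simp add: subspace_def)
  let ?Q = "quot_space V W"
  have carr: "W +>\<^bsub>V\<^esub> v \<in> carrier ?Q" if "v \<in> carrier V" for v
    using that by (auto simp: quot_space_carrier[OF S])
  have elem: thesis if "C \<in> carrier ?Q" "\<And>v. v \<in> carrier V \<Longrightarrow> C = W +>\<^bsub>V\<^esub> v \<Longrightarrow> thesis" for C thesis
    using that by (auto simp: quot_space_carrier[OF S])
  note q = quot_space_add[OF S] quot_space_smult[OF S] quot_space_zero[OF S]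
  have neg: "\<exists>D\<in>carrier ?Q. C \<oplus>\<^bsub>?Q\<^esub> D = \<zero>\<^bsub>?Q\<^esub>" if "C \<in> carrier ?Q" for C
  proof -
    obtain v where v: "v \<in> carrier V" "C = W +>\<^bsub>V\<^esub> v" using \<open>C \<in> carrier ?Q\<close> by (rule elem)
    then show ?thesis
      by (intro bexI[of _ "W +>\<^bsub>V\<^esub> (\<ominus>\<^bsub>V\<^esub> v)"]) (auto simp: q V.M.r_neg carr)
  qed
  show ?thesis
  proof (rule vs_criteria)
    show "field K" by unfold_locales
    show "\<zero>\<^bsub>?Q\<^esub> \<in> carrier ?Q" by (simp add: q carr)
    show "\<forall>v\<in>carrier ?Q. \<exists>neg_v\<in>carrier ?Q. v \<oplus>\<^bsub>?Q\<^esub> neg_v = \<zero>\<^bsub>?Q\<^esub>" using neg by blast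
    show "\<forall>v w. v \<in> carrier ?Q \<and> w \<in> carrier ?Q \<longrightarrow> v \<oplus>\<^bsub>?Q\<^esub> w \<in> carrier ?Q"
      using carr by (auto elim!: elem simp: q)
    show "\<forall>c v. c \<in> carrier K \<and> v \<in> carrier ?Q \<longrightarrow> c \<odot>\<^bsub>?Q\<^esub> v \<in> carrier ?Q"
      using carr by (auto elim!: elem simp: q)
    show "\<forall>v w. v \<in> carrier ?Q \<and> w \<in> carrier ?Q \<longrightarrow> v \<oplus>\<^bsub>?Q\<^esub> w = w \<oplus>\<^bsub>?Q\<^esub> v"
      by (auto elim!: elem simp: q V.M.a_comm)
    show "\<forall>v w x. v \<in> carrier ?Q \<and> w \<in> carrier ?Q \<and> x \<in> carrier ?Q \<longrightarrow>
        v \<oplus>\<^bsub>?Q\<^esub> w \<oplus>\<^bsub>?Q\<^esub> x = v \<oplus>\<^bsub>?Q\<^esub> (w \<oplus>\<^bsub>?Q\<^esub> x)"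
      by (auto elim!: elem simp: q V.M.a_assoc)
    show "\<forall>v\<in>carrier ?Q. v \<oplus>\<^bsub>?Q\<^esub> \<zero>\<^bsub>?Q\<^esub> = v" "\<forall>v\<in>carrier ?Q. \<one>\<^bsub>K\<^esub> \<odot>\<^bsub>?Q\<^esub> v = v"
      by (auto elim!: elem simp: q)
    show "\<forall>a b v. a \<in> carrier K \<and> b \<in> carrier K \<and> v \<in> carrier ?Q \<longrightarrow>
        (a \<otimes>\<^bsub>K\<^esub> b) \<odot>\<^bsub>?Q\<^esub> v = a \<odot>\<^bsub>?Q\<^esub> (b \<odot>\<^bsub>?Q\<^esub> v)"
      by (auto elim!: elem simp: q V.smult_assoc1)
    show "\<forall>a b v. a \<in> carrier K \<and> b \<in> carrier K \<and> v \<in> carrier ?Q \<longrightarrow>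
        (a \<oplus>\<^bsub>K\<^esub> b) \<odot>\<^bsub>?Q\<^esub> v = a \<odot>\<^bsub>?Q\<^esub> v \<oplus>\<^bsub>?Q\<^esub> b \<odot>\<^bsub>?Q\<^esub> v"
      by (auto elim!: elem simp: q V.smult_l_distr)
    show "\<forall>a v w. a \<in> carrier K \<and> v \<in> carrier ?Q \<and> w \<in> carrier ?Q \<longrightarrow>
        a \<odot>\<^bsub>?Q\<^esub> (v \<oplus>\<^bsub>?Q\<^esub> w) = a \<odot>\<^bsub>?Q\<^esub> v \<oplus>\<^bsub>?Q\<^esub> a \<odot>\<^bsub>?Q\<^esub> w"
      by (auto elim!: elem simp: q V.smult_r_distr)
  qed
qed

lemma linear_map_coset:
  assumes "subspace K W V"
  shows "linear_map K V (quot_space V W) (\<lambda>v. W +>\<^bsub>V\<^esub> v)"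
proof (rule linear_mapI)
  show "vectorspace K V" using assms by (simp add: subspace_def)
  show "vectorspace K (quot_space V W)" by (rule vectorspace_quot_space[OF assms])
  show "W +>\<^bsub>V\<^esub> v \<in> carrier (quot_space V W)" if "v \<in> carrier V" for v
    using that by (auto simp: quot_space_carrier[OF assms])
qed (simp_all only: quot_space_add[OF assms] quot_space_smult[OF assms])

text \<open>The value of \<open>h\<close> at a coset is \<open>T\<close> at a chosen representative; two representatives differ by an
element of \<open>W\<close>, which \<open>T\<close> kills.\<close>

lemma quot_space_factor:
  assumes S: "subspace K W V" and T: "linear_map K V U T"
    and kill: "\<And>w. w \<in> W \<Longrightarrow> T w = \<zero>\<^bsub>U\<^esub>"
  obtains h where "linear_map K (quot_space V W) U h"
    and "\<And>v. v \<in> carrier V \<Longrightarrow> h (W +>\<^bsub>V\<^esub> v) = T v"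
proof -
  interpret T: linear_map K V U T by fact
  let ?Q = "quot_space V W"
  note q = quot_space_carrier[OF S] quot_space_add[OF S] quot_space_smult[OF S] 
  define h where "h C = T (SOME v. v \<in> carrier V \<and> C = W +>\<^bsub>V\<^esub> v)" for C
  have h: "h (W +>\<^bsub>V\<^esub> v) = T v" if v: "v \<in> carrier V" for v
  proof -
    define u where "u = (SOME u. u \<in> carrier V \<and> W +>\<^bsub>V\<^esub> v = W +>\<^bsub>V\<^esub> u)"
    have u: "u \<in> carrier V" "W +>\<^bsub>V\<^esub> v = W +>\<^bsub>V\<^esub> u"
      unfolding u_def by (rule someI2[of _ v]; use v in simp)+
    then have "T (v \<ominus>\<^bsub>V\<^esub> u) = \<zero>\<^bsub>U\<^esub>" by (intro kill coset_eqD[OF S] v)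
    then have "T v = T u" using u(1) v by simp
    then show ?thesis by (simp add: h_def u_def)
  qed
  have "linear_map K ?Q U h"
    by (rule linear_mapI) 
      (use T.V.vectorspace_axioms T.W.vectorspace_axioms vectorspace_quot_space[OF S] in \<open>auto simp: q h\<close>)
  with h that show thesis by blast
qed

section \<open>The universal property of the tensor product\<close>

definition bilinear_map ::
  "('k, 'r) ring_scheme \<Rightarrow> ('k, 'v, 'm) module_scheme \<Rightarrow> ('k, 'w, 'n) module_scheme \<Rightarrow>
    ('k, 'u, 'p) module_scheme \<Rightarrow> ('v \<Rightarrow> 'w \<Rightarrow> 'u) \<Rightarrow> bool" where
  "bilinear_map K V W U b \<longleftrightarrow>
    (\<forall>w\<in>carrier W. linear_map K V U (\<lambda>v. b v w)) \<and> (\<forall>v\<in>carrier V. linear_map K W U (b v))"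

lemma bilinear_mapI:
  assumes "\<And>w. w \<in> carrier W \<Longrightarrow> linear_map K V U (\<lambda>v. b v w)"
    and "\<And>v. v \<in> carrier V \<Longrightarrow> linear_map K W U (b v)"
  shows "bilinear_map K V W U b"
  using assms by (simp add: bilinear_map_def)

lemma bilinear_map_left: "bilinear_map K V W U b \<Longrightarrow> w \<in> carrier W \<Longrightarrow> linear_map K V U (\<lambda>v. b v w)"
  and bilinear_map_right: "bilinear_map K V W U b \<Longrightarrow> v \<in> carrier V \<Longrightarrow> linear_map K W U (b v)"
  by (simp_all add: bilinear_map_def)

lemma bilinear_map_comp:
  assumes "linear_map K U X f" "bilinear_map K V W U b"
  shows "bilinear_map K V W X (\<lambda>v w. f (b v w))"
  using assms by (auto simp: bilinear_map_def intro: linear_map_comp)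

locale tensor_product = V: vectorspace K V + W: vectorspace K W
  for K :: "('k, 'r) ring_scheme" and V :: "('k, 'v, 'm) module_scheme"
    and W :: "('k, 'w, 'n) module_scheme"
begin

abbreviation "F \<equiv> free_space K (carrier V \<times> carrier W)"
abbreviation "T \<equiv> tensor_space K V W"
abbreviation "N \<equiv> tensor_null K V W"
abbreviation "gen \<equiv> free_gen K"
abbreviation "tens \<equiv> tensor K V W"

sublocale F: vectorspace K F
  by (rule vectorspace_free_space) unfold_locales

lemma gen_closed: "v \<in> carrier V \<Longrightarrow> w \<in> carrier W \<Longrightarrow> gen (v, w) \<in> carrier F"
  by (rule free_gen_closed) (auto intro: V.field_axioms)

lemma tensor_relations_closed: "tensor_relations K V W \<subseteq> carrier F"
  unfolding tensor_relations_def Let_def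
  by (intro Un_least) (auto simp only: mem_Collect_eq intro!: F.M.minus_closed F.M.a_closed
      F.smult_closed gen_closed V.M.a_closed W.M.a_closed V.smult_closed W.smult_closed)

lemma subspace_tensor_null: "subspace K N F"
  unfolding tensor_null_def by (rule F.span_is_subspace[OF tensor_relations_closed])

lemma tensor_relations_null: "tensor_relations K V W \<subseteq> N"
  unfolding tensor_null_def by (rule F.in_own_span[OF tensor_relations_closed])

sublocale T: vectorspace K T
  unfolding tensor_space_def by (rule vectorspace_quot_space[OF subspace_tensor_null])

lemma linear_map_class: "linear_map K F T (\<lambda>f. N +>\<^bsub>F\<^esub> f)"
  unfolding tensor_space_def by (rule linear_map_coset[OF subspace_tensor_null])

lemma tensor_closed [simp]:
  "v \<in> carrier V \<Longrightarrow> w \<in> carrier W \<Longrightarrow> tens v w \<in> carrier T"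
  unfolding tensor_def by (rule linear_map_closed[OF linear_map_class gen_closed])

lemma class_eqI:
  assumes "f \<in> carrier F" "g \<in> carrier F" "f \<ominus>\<^bsub>F\<^esub> g \<in> tensor_relations K V W"
  shows "N +>\<^bsub>F\<^esub> f = N +>\<^bsub>F\<^esub> g"
  using assms tensor_relations_null by (intro coset_eqI[OF subspace_tensor_null]) auto

lemma tensor_add_left:
  assumes "v \<in> carrier V" "v' \<in> carrier V" "w \<in> carrier W"
  shows "tens (v \<oplus>\<^bsub>V\<^esub> v') w = tens v w \<oplus>\<^bsub>T\<^esub> tens v' w"
proof -
  have "N +>\<^bsub>F\<^esub> gen (v \<oplus>\<^bsub>V\<^esub> v', w) = N +>\<^bsub>F\<^esub> (gen (v, w) \<oplus>\<^bsub>F\<^esub> gen (v', w))"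
    by (rule class_eqI) (use assms in \<open>auto simp: gen_closed tensor_relations_def Let_def\<close>)
  then show ?thesis
    using assms by (simp add: tensor_def linear_map_add[OF linear_map_class] gen_closed)
qed

lemma tensor_add_right:
  assumes "v \<in> carrier V" "w \<in> carrier W" "w' \<in> carrier W"
  shows "tens v (w \<oplus>\<^bsub>W\<^esub> w') = tens v w \<oplus>\<^bsub>T\<^esub> tens v w'"
proof -
  have "N +>\<^bsub>F\<^esub> gen (v, w \<oplus>\<^bsub>W\<^esub> w') = N +>\<^bsub>F\<^esub> (gen (v, w) \<oplus>\<^bsub>F\<^esub> gen (v, w'))"
    by (rule class_eqI) (use assms in \<open>auto simp: gen_closed tensor_relations_def Let_def\<close>)
  then show ?thesis
    using assms by (simp add: tensor_def linear_map_add[OF linear_map_class] gen_closed)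
qed

lemma tensor_smult_left:
  assumes "a \<in> carrier K" "v \<in> carrier V" "w \<in> carrier W"
  shows "tens (a \<odot>\<^bsub>V\<^esub> v) w = a \<odot>\<^bsub>T\<^esub> tens v w"
proof -
  have "N +>\<^bsub>F\<^esub> gen (a \<odot>\<^bsub>V\<^esub> v, w) = N +>\<^bsub>F\<^esub> (a \<odot>\<^bsub>F\<^esub> gen (v, w))"
    by (rule class_eqI) (use assms in \<open>auto simp: gen_closed tensor_relations_def Let_def\<close>)
  then show ?thesis
    using assms by (simp add: tensor_def linear_map_smult[OF linear_map_class] gen_closed)
qed

lemma tensor_smult_right:
  assumes "a \<in> carrier K" "v \<in> carrier V" "w \<in> carrier W"
  shows "tens v (a \<odot>\<^bsub>W\<^esub> w) = a \<odot>\<^bsub>T\<^esub> tens v w"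
proof -
  have "N +>\<^bsub>F\<^esub> gen (v, a \<odot>\<^bsub>W\<^esub> w) = N +>\<^bsub>F\<^esub> (a \<odot>\<^bsub>F\<^esub> gen (v, w))"
    by (rule class_eqI) (use assms in \<open>auto simp: gen_closed tensor_relations_def Let_def\<close>)
  then show ?thesis
    using assms by (simp add: tensor_def linear_map_smult[OF linear_map_class] gen_closed)
qed

lemma bilinear_tensor: "bilinear_map K V W T tens"
proof (rule bilinear_mapI)
  show "linear_map K V T (\<lambda>v. tens v w)" if "w \<in> carrier W" for w
    using that V.vectorspace_axioms T.vectorspace_axioms
    by (intro linear_mapI) (simp_all add: tensor_add_left tensor_smult_left)
  show "linear_map K W T (tens v)" if "v \<in> carrier V" for v
    using that W.vectorspace_axioms T.vectorspace_axioms
    by (intro linear_mapI) (simp_all add: tensor_add_right tensor_smult_right)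
qed

text \<open>Sums of pure tensors exhaust \<open>V \<otimes> W\<close>: a scalar coefficient of a generator is absorbed into the
left factor, and zero is itself the pure tensor of two zeros.\<close>

lemma tensor_induct [consumes 1, case_names tensor add]:
  assumes t: "t \<in> carrier T"
    and tensor: "\<And>v w. v \<in> carrier V \<Longrightarrow> w \<in> carrier W \<Longrightarrow> P (tens v w)"
    and add: "\<And>s t. s \<in> carrier T \<Longrightarrow> t \<in> carrier T \<Longrightarrow> P s \<Longrightarrow> P t \<Longrightarrow> P (s \<oplus>\<^bsub>T\<^esub> t)"
  shows "P t"
proof -
  have cls: "N +>\<^bsub>F\<^esub> f \<in> carrier T" if "f \<in> carrier F" for f
    using linear_map_closed[OF linear_map_class that] .
  have "P (N +>\<^bsub>F\<^esub> f)" if "f \<in> carrier F" for f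
    using V.field_axioms that
  proof (induction rule: free_space_induct)
    case zero
    have "tens \<zero>\<^bsub>V\<^esub> \<zero>\<^bsub>W\<^esub> = \<zero>\<^bsub>T\<^esub>"
      by (rule linear_map_zero[OF bilinear_map_right[OF bilinear_tensor]]) simp
    also have "\<dots> = N +>\<^bsub>F\<^esub> \<zero>\<^bsub>F\<^esub>" using linear_map_zero[OF linear_map_class] by simp
    finally show ?case using tensor[of "\<zero>\<^bsub>V\<^esub>" "\<zero>\<^bsub>W\<^esub>"] by simp
  next
    case (step a x f)
    obtain v w where x: "x = (v, w)" "v \<in> carrier V" "w \<in> carrier W" using step.hyps(2) by auto
    have "N +>\<^bsub>F\<^esub> (a \<odot>\<^bsub>F\<^esub> gen x \<oplus>\<^bsub>F\<^esub> f) = tens (a \<odot>\<^bsub>V\<^esub> v) w \<oplus>\<^bsub>T\<^esub> (N +>\<^bsub>F\<^esub> f)"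
      using step.hyps x
      by (simp add: gen_closed linear_map_add[OF linear_map_class]
          linear_map_smult[OF linear_map_class] tensor_smult_left) (simp add: tensor_def)
    moreover have "P (tens (a \<odot>\<^bsub>V\<^esub> v) w \<oplus>\<^bsub>T\<^esub> (N +>\<^bsub>F\<^esub> f))"
      using step x by (intro add tensor tensor_closed cls) auto
    ultimately show ?case by simp
  qed
  moreover obtain f where "f \<in> carrier F" "t = N +>\<^bsub>F\<^esub> f"
    using t by (auto simp: tensor_space_def quot_space_carrier[OF subspace_tensor_null])
  ultimately show ?thesis by simp
qed

text \<open>The extension of \<open>b\<close> to the free space kills the four kinds of relations exactly because \<open>b\<close> is
bilinear. Its kernel is a subspace, so it contains their span, and the extension descends to the
quotient.\<close>

lemma tensor_space_factor:
  assumes b: "bilinear_map K V W U b"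
  obtains h where "linear_map K T U h" "\<And>v w. v \<in> carrier V \<Longrightarrow> w \<in> carrier W \<Longrightarrow> h (tens v w) = b v w"
proof -
  note left = bilinear_map_left[OF b] and right = bilinear_map_right[OF b]
  interpret U: vectorspace K U
    by (rule linear_map_cod[OF right[OF V.M.zero_closed]])
  have closed: "b v w \<in> carrier U" if "v \<in> carrier V" "w \<in> carrier W" for v w
    using linear_map_closed[OF right] that .
  define L where "L = free_lift K U (case_prod b)"
  have L: "linear_map K F U L"
    unfolding L_def using closed by (intro linear_map_free_lift U.vectorspace_axioms) auto
  interpret L: linear_map K F U L by fact
  have gen: "L (gen (v, w)) = b v w" if "v \<in> carrier V" "w \<in> carrier W" for v w
    unfolding L_def using closed that
    by (subst free_lift_gen[where X = "carrier V \<times> carrier W"]) (auto intro: U.vectorspace_axioms)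
  have "tensor_relations K V W \<subseteq> L.ker"
  proof
    fix r assume r: "r \<in> tensor_relations K V W"
    then have "L r = \<zero>\<^bsub>U\<^esub>"
      unfolding tensor_relations_def Let_def
      by (elim UnE CollectE exE conjE)
        (simp_all add: gen gen_closed closed linear_map_add[OF left] linear_map_add[OF right]
          linear_map_smult[OF left] linear_map_smult[OF right])
    with r show "r \<in> L.ker" using tensor_relations_closed by (auto simp: L.ker_def)
  qed
  then have "N \<subseteq> L.ker"
    unfolding tensor_null_def using L.ker_is_submodule by (rule F.span_is_subset)
  then have "L f = \<zero>\<^bsub>U\<^esub>" if "f \<in> N" for f using that by (auto simp: L.ker_def)
  then obtain h where h: "linear_map K (quot_space F N) U h"
    "\<And>f. f \<in> carrier F \<Longrightarrow> h (N +>\<^bsub>F\<^esub> f) = L f"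
    using quot_space_factor[OF subspace_tensor_null L] by blast
  show thesis
  proof
    show "linear_map K T U h" using h(1) by (simp add: tensor_space_def)
    show "h (tens v w) = b v w" if "v \<in> carrier V" "w \<in> carrier W" for v w
      using that by (simp add: tensor_def h(2) gen gen_closed)
  qed
qed

lemma linear_map_tensor_eqI:
  assumes "linear_map K T U f" "linear_map K T U g"
    and "\<And>v w. v \<in> carrier V \<Longrightarrow> w \<in> carrier W \<Longrightarrow> f (tens v w) = g (tens v w)"
    and "t \<in> carrier T"
  shows "f t = g t"
  using assms(4)
  by (induction rule: tensor_induct)
    (simp_all add: assms(3) linear_map_add[OF assms(1)] linear_map_add[OF assms(2)])

text \<open>\<open>tensor_lift\<close> is a definite description; restricting any factorisation to the carrier gives the
unique extensional one.\<close>

lemma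
  assumes b: "bilinear_map K V W U b"
  shows linear_map_tensor_lift: "linear_map K T U (tensor_lift K V W U b)"
    and tensor_lift_tensor: "\<And>v w. v \<in> carrier V \<Longrightarrow> w \<in> carrier W \<Longrightarrow>
      tensor_lift K V W U b (tens v w) = b v w"
proof -
  let ?P = "\<lambda>h. h \<in> extensional (carrier T) \<and> linear_map K T U h \<and>
    (\<forall>v\<in>carrier V. \<forall>w\<in>carrier W. h (tens v w) = b v w)"
  obtain h where h: "linear_map K T U h"
    "\<And>v w. v \<in> carrier V \<Longrightarrow> w \<in> carrier W \<Longrightarrow> h (tens v w) = b v w"
    using tensor_space_factor[OF b] by blast
  have "\<exists>!h. ?P h"
  proof (rule ex1I)
    show "?P (restrict h (carrier T))" using linear_map_restrict[OF h(1)] h(2) by simp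
    show "h' = restrict h (carrier T)" if "?P h'" for h'
      using that h(2) linear_map_tensor_eqI[OF _ h(1), of h']
      by (intro extensionalityI[where A = "carrier T"]) auto
  qed
  from theI'[OF this] show "linear_map K T U (tensor_lift K V W U b)"
    "\<And>v w. v \<in> carrier V \<Longrightarrow> w \<in> carrier W \<Longrightarrow> tensor_lift K V W U b (tens v w) = b v w"
    unfolding tensor_lift_def by blast+
qed

end

section \<open>Triple tensor products and associativity\<close>

lemma tensor_productI: "vectorspace K V \<Longrightarrow> vectorspace K W \<Longrightarrow> tensor_product K V W"
  by (rule tensor_product.intro)

lemma vectorspace_tensor_space:
  assumes "vectorspace K V" "vectorspace K W"
  shows "vectorspace K (tensor_space K V W)"
proof -
  interpret tensor_product K V W using assms by (rule tensor_productI)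
  show ?thesis by (rule T.vectorspace_axioms)
qed

lemma
  assumes f: "linear_map K V V' f" and g: "linear_map K W W' g"
  shows linear_map_tensor_map:
      "linear_map K (tensor_space K V W) (tensor_space K V' W') (tensor_map K V W V' W' f g)"
    and tensor_map_tensor: "\<And>v w. v \<in> carrier V \<Longrightarrow> w \<in> carrier W \<Longrightarrow>
      tensor_map K V W V' W' f g (tensor K V W v w) = tensor K V' W' (f v) (g w)"
proof -
  have A: "tensor_product K V W" and B: "tensor_product K V' W'"
    using linear_mapD(1,2)[OF f] linear_mapD(1,2)[OF g] by (auto intro: tensor_productI)
  note b = tensor_product.bilinear_tensor[OF B]
  have "bilinear_map K V W (tensor_space K V' W') (\<lambda>v w. tensor K V' W' (f v) (g w))"
  proof (rule bilinear_mapI)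
    show "linear_map K V (tensor_space K V' W') (\<lambda>v. tensor K V' W' (f v) (g w))"
      if "w \<in> carrier W" for w
      using linear_map_comp[OF f bilinear_map_left[OF b linear_map_closed[OF g that]]] .
    show "linear_map K W (tensor_space K V' W') (\<lambda>w. tensor K V' W' (f v) (g w))"
      if "v \<in> carrier V" for v
      using linear_map_comp[OF g bilinear_map_right[OF b linear_map_closed[OF f that]]] .
  qed
  from tensor_product.linear_map_tensor_lift[OF A this] tensor_product.tensor_lift_tensor[OF A this]
  show "linear_map K (tensor_space K V W) (tensor_space K V' W') (tensor_map K V W V' W' f g)"
    "\<And>v w. v \<in> carrier V \<Longrightarrow> w \<in> carrier W \<Longrightarrow>
      tensor_map K V W V' W' f g (tensor K V W v w) = tensor K V' W' (f v) (g w)"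
    by (simp_all only: tensor_map_def)
qed

locale tensor_triple =
  fixes K :: "('k, 'r) ring_scheme" and U :: "('k, 'u, 'l) module_scheme"
    and V :: "('k, 'v, 'm) module_scheme" and W :: "('k, 'w, 'n) module_scheme"
  assumes U: "vectorspace K U" and V: "vectorspace K V" and W: "vectorspace K W"
begin

abbreviation "UV \<equiv> tensor_space K U V"
abbreviation "VW \<equiv> tensor_space K V W"
abbreviation "UV_W \<equiv> tensor_space K UV W"
abbreviation "U_VW \<equiv> tensor_space K U VW"
abbreviation "tens_left u v w \<equiv> tensor K UV W (tensor K U V u v) w"
abbreviation "tens_right u v w \<equiv> tensor K U VW u (tensor K V W v w)"

lemma tp_UV: "tensor_product K U V" and tp_VW: "tensor_product K V W"
  and tp_UV_W: "tensor_product K UV W" and tp_U_VW: "tensor_product K U VW"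
  by (intro tensor_productI vectorspace_tensor_space U V W)+

lemma tens_left_linear:
  shows "v \<in> carrier V \<Longrightarrow> w \<in> carrier W \<Longrightarrow> linear_map K U UV_W (\<lambda>u. tens_left u v w)"
    and "u \<in> carrier U \<Longrightarrow> w \<in> carrier W \<Longrightarrow> linear_map K V UV_W (\<lambda>v. tens_left u v w)"
    and "u \<in> carrier U \<Longrightarrow> v \<in> carrier V \<Longrightarrow> linear_map K W UV_W (\<lambda>w. tens_left u v w)"
proof -
  note b = tensor_product.bilinear_tensor[OF tp_UV] and c = tensor_product.bilinear_tensor[OF tp_UV_W]
  show "linear_map K U UV_W (\<lambda>u. tens_left u v w)" if "v \<in> carrier V" "w \<in> carrier W"
    using linear_map_comp[OF bilinear_map_left[OF b that(1)] bilinear_map_left[OF c that(2)]] .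
  show "linear_map K V UV_W (\<lambda>v. tens_left u v w)" if "u \<in> carrier U" "w \<in> carrier W"
    using linear_map_comp[OF bilinear_map_right[OF b that(1)] bilinear_map_left[OF c that(2)]] .
  show "linear_map K W UV_W (\<lambda>w. tens_left u v w)" if "u \<in> carrier U" "v \<in> carrier V"
    using bilinear_map_right[OF c tensor_product.tensor_closed[OF tp_UV that]] .
qed

lemma tens_right_linear:
  shows "v \<in> carrier V \<Longrightarrow> w \<in> carrier W \<Longrightarrow> linear_map K U U_VW (\<lambda>u. tens_right u v w)"
    and "u \<in> carrier U \<Longrightarrow> w \<in> carrier W \<Longrightarrow> linear_map K V U_VW (\<lambda>v. tens_right u v w)"
    and "u \<in> carrier U \<Longrightarrow> v \<in> carrier V \<Longrightarrow> linear_map K W U_VW (\<lambda>w. tens_right u v w)"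
proof -
  note b = tensor_product.bilinear_tensor[OF tp_VW] and c = tensor_product.bilinear_tensor[OF tp_U_VW]
  show "linear_map K U U_VW (\<lambda>u. tens_right u v w)" if "v \<in> carrier V" "w \<in> carrier W"
    using bilinear_map_left[OF c tensor_product.tensor_closed[OF tp_VW that]] .
  show "linear_map K V U_VW (\<lambda>v. tens_right u v w)" if "u \<in> carrier U" "w \<in> carrier W"
    using linear_map_comp[OF bilinear_map_left[OF b that(2)] bilinear_map_right[OF c that(1)]] .
  show "linear_map K W U_VW (\<lambda>w. tens_right u v w)" if "u \<in> carrier U" "v \<in> carrier V"
    using linear_map_comp[OF bilinear_map_right[OF b that(2)] bilinear_map_right[OF c that(1)]] .
qed

text \<open>A trilinear map can be lifted along its first two arguments. Linearity of the result in the third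
argument, for a general tensor \<open>t\<close>, follows by induction on \<open>t\<close>.\<close>

lemma bilinear_lift_left:
  assumes lin: "\<And>v w. v \<in> carrier V \<Longrightarrow> w \<in> carrier W \<Longrightarrow> linear_map K U X (\<lambda>u. c u v w)"
    "\<And>u w. u \<in> carrier U \<Longrightarrow> w \<in> carrier W \<Longrightarrow> linear_map K V X (\<lambda>v. c u v w)"
    "\<And>u v. u \<in> carrier U \<Longrightarrow> v \<in> carrier V \<Longrightarrow> linear_map K W X (\<lambda>w. c u v w)"
  shows "bilinear_map K UV W X (\<lambda>t w. tensor_lift K U V X (\<lambda>u v. c u v w) t)"
proof (rule bilinear_mapI)
  have bil: "bilinear_map K U V X (\<lambda>u v. c u v w)" if "w \<in> carrier W" for w
    using lin that by (intro bilinear_mapI)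
  note lift = tensor_product.linear_map_tensor_lift[OF tp_UV bil]
  show "linear_map K UV X (\<lambda>t. tensor_lift K U V X (\<lambda>u v. c u v w) t)" if "w \<in> carrier W" for w
    using lift[OF that] .
  show "linear_map K W X (\<lambda>w. tensor_lift K U V X (\<lambda>u v. c u v w) t)" if t: "t \<in> carrier UV" for t
    using t
  proof (induction rule: tensor_product.tensor_induct[OF tp_UV, consumes 1, case_names tensor add])
    case (tensor u v)
    then show ?case
      by (intro linear_map_cong[OF lin(3)]) (simp_all add: tensor_product.tensor_lift_tensor[OF tp_UV bil])
  next
    case (add s t)
    then show ?case
      by (intro linear_map_cong[OF linear_map_sum[OF add.IH]]) (simp add: linear_map_add[OF lift])
  qed
qed

lemma bilinear_lift_right:
  assumes lin: "\<And>v w. v \<in> carrier V \<Longrightarrow> w \<in> carrier W \<Longrightarrow> linear_map K U X (\<lambda>u. c u v w)"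
    "\<And>u w. u \<in> carrier U \<Longrightarrow> w \<in> carrier W \<Longrightarrow> linear_map K V X (\<lambda>v. c u v w)"
    "\<And>u v. u \<in> carrier U \<Longrightarrow> v \<in> carrier V \<Longrightarrow> linear_map K W X (\<lambda>w. c u v w)"
  shows "bilinear_map K U VW X (\<lambda>u t. tensor_lift K V W X (\<lambda>v w. c u v w) t)"
proof (rule bilinear_mapI)
  have bil: "bilinear_map K V W X (\<lambda>v w. c u v w)" if "u \<in> carrier U" for u
    using lin that by (intro bilinear_mapI)
  note lift = tensor_product.linear_map_tensor_lift[OF tp_VW bil]
  show "linear_map K VW X (\<lambda>t. tensor_lift K V W X (\<lambda>v w. c u v w) t)" if "u \<in> carrier U" for u
    using lift[OF that] .
  show "linear_map K U X (\<lambda>u. tensor_lift K V W X (\<lambda>v w. c u v w) t)" if t: "t \<in> carrier VW" for t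
    using t
  proof (induction rule: tensor_product.tensor_induct[OF tp_VW, consumes 1, case_names tensor add])
    case (tensor v w)
    then show ?case
      by (intro linear_map_cong[OF lin(1)]) (simp_all add: tensor_product.tensor_lift_tensor[OF tp_VW bil])
  next
    case (add s t)
    then show ?case
      by (intro linear_map_cong[OF linear_map_sum[OF add.IH]]) (simp add: linear_map_add[OF lift])
  qed
qed

text \<open>For fixed \<open>w\<close> both maps are linear in the first factor, which may therefore be taken to be a pure
tensor \<open>u \<otimes> v\<close>.\<close>

lemma linear_map_tens_left_eqI:
  assumes "linear_map K UV_W X f" "linear_map K UV_W X g"
    and eq: "\<And>u v w. u \<in> carrier U \<Longrightarrow> v \<in> carrier V \<Longrightarrow> w \<in> carrier W \<Longrightarrow>
      f (tens_left u v w) = g (tens_left u v w)"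
    and t: "t \<in> carrier UV_W"
  shows "f t = g t"
  using assms(1,2) _ t
proof (rule tensor_product.linear_map_tensor_eqI[OF tp_UV_W])
  fix s w assume s: "s \<in> carrier UV" and w: "w \<in> carrier W"
  note b = bilinear_map_left[OF tensor_product.bilinear_tensor[OF tp_UV_W] w]
  show "f (tensor K UV W s w) = g (tensor K UV W s w)"
    by (rule tensor_product.linear_map_tensor_eqI[OF tp_UV linear_map_comp[OF b assms(1)]
          linear_map_comp[OF b assms(2)] eq[OF _ _ w] s])
qed

lemma linear_map_tens_right_eqI:
  assumes "linear_map K U_VW X f" "linear_map K U_VW X g"
    and eq: "\<And>u v w. u \<in> carrier U \<Longrightarrow> v \<in> carrier V \<Longrightarrow> w \<in> carrier W \<Longrightarrow>
      f (tens_right u v w) = g (tens_right u v w)"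
    and t: "t \<in> carrier U_VW"
  shows "f t = g t"
  using assms(1,2) _ t
proof (rule tensor_product.linear_map_tensor_eqI[OF tp_U_VW])
  fix s u assume s: "s \<in> carrier VW" and u: "u \<in> carrier U"
  note b = bilinear_map_right[OF tensor_product.bilinear_tensor[OF tp_U_VW] u]
  show "f (tensor K U VW u s) = g (tensor K U VW u s)"
    by (rule tensor_product.linear_map_tensor_eqI[OF tp_VW linear_map_comp[OF b assms(1)]
          linear_map_comp[OF b assms(2)] eq[OF u] s])
qed

abbreviation "assoc \<equiv> tensor_assoc K U V W"

text \<open>The inverse of the associativity map, obtained from the universal property in the same way.\<close>

definition unassoc :: "('u \<times> ('v \<times> 'w \<Rightarrow> 'k) set \<Rightarrow> 'k) set \<Rightarrow> (('u \<times> 'v \<Rightarrow> 'k) set \<times> 'w \<Rightarrow> 'k) set"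
  where "unassoc =
    tensor_lift K U VW UV_W (\<lambda>u t. tensor_lift K V W UV_W (\<lambda>v w. tens_left u v w) t)"

lemma linear_map_assoc: "linear_map K UV_W U_VW assoc"
  and assoc_tens_left: "u \<in> carrier U \<Longrightarrow> v \<in> carrier V \<Longrightarrow> w \<in> carrier W \<Longrightarrow>
    assoc (tens_left u v w) = tens_right u v w"
proof -
  note b = bilinear_lift_left[OF tens_right_linear]
  show "linear_map K UV_W U_VW assoc"
    unfolding tensor_assoc_def Let_def by (rule tensor_product.linear_map_tensor_lift[OF tp_UV_W b])
  show "assoc (tens_left u v w) = tens_right u v w"
    if "u \<in> carrier U" "v \<in> carrier V" "w \<in> carrier W"
  proof -
    have c: "bilinear_map K U V U_VW (\<lambda>u v. tens_right u v w)"
      by (intro bilinear_mapI tens_right_linear that)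
    show ?thesis
      unfolding tensor_assoc_def Let_def
      by (simp only: tensor_product.tensor_lift_tensor[OF tp_UV_W b] that
          tensor_product.tensor_closed[OF tp_UV] tensor_product.tensor_lift_tensor[OF tp_UV c])
  qed
qed

lemma linear_map_unassoc: "linear_map K U_VW UV_W unassoc"
  and unassoc_tens_right: "u \<in> carrier U \<Longrightarrow> v \<in> carrier V \<Longrightarrow> w \<in> carrier W \<Longrightarrow>
    unassoc (tens_right u v w) = tens_left u v w"
proof -
  note b = bilinear_lift_right[OF tens_left_linear]
  show "linear_map K U_VW UV_W unassoc"
    unfolding unassoc_def by (rule tensor_product.linear_map_tensor_lift[OF tp_U_VW b])
  show "unassoc (tens_right u v w) = tens_left u v w"
    if "u \<in> carrier U" "v \<in> carrier V" "w \<in> carrier W"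
  proof -
    have c: "bilinear_map K V W UV_W (\<lambda>v w. tens_left u v w)"
      by (intro bilinear_mapI tens_left_linear that)
    show ?thesis
      unfolding unassoc_def
      by (simp only: tensor_product.tensor_lift_tensor[OF tp_U_VW b] that
          tensor_product.tensor_closed[OF tp_VW] tensor_product.tensor_lift_tensor[OF tp_VW c])
  qed
qed

lemma unassoc_assoc: "t \<in> carrier UV_W \<Longrightarrow> unassoc (assoc t) = t"
  by (rule linear_map_tens_left_eqI[OF linear_map_comp[OF linear_map_assoc linear_map_unassoc]
        linear_map_id[OF linear_map_dom[OF linear_map_assoc]]])
    (simp_all add: assoc_tens_left unassoc_tens_right)

lemma assoc_unassoc: "t \<in> carrier U_VW \<Longrightarrow> assoc (unassoc t) = t"
  by (rule linear_map_tens_right_eqI[OF linear_map_comp[OF linear_map_unassoc linear_map_assoc]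
        linear_map_id[OF linear_map_dom[OF linear_map_unassoc]]])
    (simp_all add: assoc_tens_left unassoc_tens_right)

lemma inv_into_assoc: "t \<in> carrier U_VW \<Longrightarrow> inv_into (carrier UV_W) assoc t = unassoc t"
  by (rule inv_into_f_eq[OF inj_on_inverseI[where g = unassoc]])
    (simp_all add: unassoc_assoc assoc_unassoc linear_map_closed[OF linear_map_unassoc])

end

section \<open>The operators R12 and R23 on pure tensors\<close>

lemma
  assumes R: "linear_map K (tensor_space K V V) (tensor_space K V V) R" and V: "vectorspace K V"
  shows linear_map_R12: "linear_map K (tensor_cube K V) (tensor_cube K V) (R12 K V R)"
    and R12_tensor: "\<And>t w. t \<in> carrier (tensor_space K V V) \<Longrightarrow> w \<in> carrier V \<Longrightarrow>
      R12 K V R (tensor K (tensor_space K V V) V t w) = tensor K (tensor_space K V V) V (R t) w"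
  using linear_map_tensor_map[OF R linear_map_id[OF V]] tensor_map_tensor[OF R linear_map_id[OF V]]
  by (simp_all add: R12_def tensor_cube_def)

text \<open>The value of \<open>R\<close> at \<open>v \<otimes> w\<close> is in general not a pure tensor, so the right-hand side keeps
\<open>unassoc\<close>. As \<open>t \<mapsto> unassoc (u \<otimes> t)\<close> is linear, it can be evaluated once \<open>R (v \<otimes> w)\<close> is written
as a sum of pure tensors.\<close>

lemma
  assumes R: "linear_map K (tensor_space K V V) (tensor_space K V V) R" and V: "vectorspace K V"
  shows linear_map_R23: "linear_map K (tensor_cube K V) (tensor_cube K V) (R23 K V R)"
    and R23_tensor: "\<And>u v w. u \<in> carrier V \<Longrightarrow> v \<in> carrier V \<Longrightarrow> w \<in> carrier V \<Longrightarrow>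
      R23 K V R (tensor K (tensor_space K V V) V (tensor K V V u v) w) =
      tensor_triple.unassoc K V V V (tensor K V (tensor_space K V V) u (R (tensor K V V v w)))"
proof -
  interpret tensor_triple K V V V by (rule tensor_triple.intro[OF V V V])
  note m = linear_map_tensor_map[OF linear_map_id[OF V] R]
  have R23: "R23 K V R t = unassoc (tensor_map K V UV V UV (\<lambda>v. v) R (assoc t))"
    if "t \<in> carrier UV_W" for t
    using inv_into_assoc[OF linear_map_closed[OF m linear_map_closed[OF linear_map_assoc that]]]
    by (simp add: R23_def tensor_cube_def)
  show "linear_map K (tensor_cube K V) (tensor_cube K V) (R23 K V R)"
    unfolding tensor_cube_def
    by (rule linear_map_cong[OF linear_map_comp[OF linear_map_comp[OF linear_map_assoc m]
            linear_map_unassoc] R23])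
  show "R23 K V R (tens_left u v w) = unassoc (tensor K V UV u (R (tensor K V V v w)))"
    if "u \<in> carrier V" "v \<in> carrier V" "w \<in> carrier V" for u v w
    using that
    by (simp add: R23 linear_map_closed[OF tens_left_linear(1)] assoc_tens_left
        tensor_map_tensor[OF linear_map_id[OF V] R] tensor_product.tensor_closed[OF tp_UV])
qed

section \<open>Signs\<close>

lemma (in field)
  shows koszul_sign_closed: "koszul_sign R i j \<in> carrier R"
    and koszul_sign_square: "koszul_sign R i j \<otimes> koszul_sign R i j = \<one>"
    and koszul_sign_commute: "koszul_sign R i j = koszul_sign R j i"
    and koszul_sign_zero: "koszul_sign R 0 j = \<one>" "koszul_sign R i 0 = \<one>"
    and koszul_sign_one: "koszul_sign R 1 1 = \<ominus> \<one>"
    and koszul_sign_add: "koszul_sign R ((i + j) mod 2) l = koszul_sign R i l \<otimes> koszul_sign R j l"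
proof -
  have sq: "(\<ominus> \<one>) [^] n \<otimes> (\<ominus> \<one>) [^] n = \<one>" for n :: nat
    by (simp add: nat_pow_distrib[symmetric] l_minus r_minus)
  show "koszul_sign R i j \<in> carrier R" "koszul_sign R i j = koszul_sign R j i"
    "koszul_sign R 0 j = \<one>" "koszul_sign R i 0 = \<one>" "koszul_sign R 1 1 = \<ominus> \<one>"
    "koszul_sign R i j \<otimes> koszul_sign R i j = \<one>"
    using sq by (simp_all add: koszul_sign_def mult.commute)
  \<comment> \<open>Reducing \<open>i + j\<close> modulo 2 changes the exponent by an even number.\<close>
  have "(\<ominus> \<one>) [^] (((i + j) div 2 * l) + ((i + j) div 2 * l)) = \<one>"
    using sq by (simp add: nat_pow_mult[symmetric])
  moreover have "(i + j) * l = (i + j) mod 2 * l + (((i + j) div 2 * l) + ((i + j) div 2 * l))"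
    by (metis (no_types, opaque_lifting) add_mult_distrib mod_mult_div_eq mult_2)
  ultimately have "(\<ominus> \<one>) [^] ((i + j) * l) = (\<ominus> \<one>) [^] ((i + j) mod 2 * l)"
    by (metis a_inv_closed nat_pow_closed nat_pow_mult one_closed r_one)
  then show "koszul_sign R ((i + j) mod 2) l = koszul_sign R i l \<otimes> koszul_sign R j l"
    by (simp add: koszul_sign_def nat_pow_mult add_mult_distrib)
qed

section \<open>Graded spaces\<close>

context lie_superalgebra
begin

abbreviation "LL \<equiv> tensor_space K L L"
abbreviation "tens \<equiv> tensor K L L"
abbreviation "\<epsilon> \<equiv> koszul_sign K"

lemma L: "vectorspace K L" ..

lemma tp: "tensor_product K L L"
  by (rule tensor_productI[OF L L])

lemma grade_closed: "i \<in> {0, 1} \<Longrightarrow> x \<in> G i \<Longrightarrow> x \<in> carrier L"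
  using grade_subspace[of i] by (auto simp: subspace_def submodule_def)

lemma grade_decompose:
  assumes "x \<in> carrier L"
  obtains u v where "u \<in> G 0" "v \<in> G 1" "x = u \<oplus>\<^bsub>L\<^esub> v"
  using assms grade_sum by (auto simp: submodule_sum_def)

lemma grade_add: "i \<in> {0, 1} \<Longrightarrow> x \<in> G i \<Longrightarrow> y \<in> G i \<Longrightarrow> x \<oplus>\<^bsub>L\<^esub> y \<in> G i"
  and grade_smult: "i \<in> {0, 1} \<Longrightarrow> a \<in> carrier K \<Longrightarrow> x \<in> G i \<Longrightarrow> a \<odot>\<^bsub>L\<^esub> x \<in> G i"
  and grade_zero: "i \<in> {0, 1} \<Longrightarrow> \<zero>\<^bsub>L\<^esub> \<in> G i"
  using grade_subspace[of i] by (auto simp: subspace_def submodule_def)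

lemma grade_minus:
  assumes "i \<in> {0, 1}" "x \<in> G i" "y \<in> G i"
  shows "x \<ominus>\<^bsub>L\<^esub> y \<in> G i"
proof -
  have "x \<ominus>\<^bsub>L\<^esub> y = x \<oplus>\<^bsub>L\<^esub> (\<ominus>\<^bsub>K\<^esub> \<one>\<^bsub>K\<^esub>) \<odot>\<^bsub>L\<^esub> y"
    using assms grade_closed by (simp add: smult_minus_1 a_minus_def)
  then show ?thesis using assms grade_add grade_smult by simp
qed

text \<open>The difference of the even parts equals that of the odd parts, and only zero is both even and odd.\<close>

lemma grade_decompose_unique:
  assumes "u \<in> G 0" "u' \<in> G 0" "v \<in> G 1" "v' \<in> G 1" "u \<oplus>\<^bsub>L\<^esub> v = u' \<oplus>\<^bsub>L\<^esub> v'"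
  shows "u = u'" "v = v'"
proof -
  have c: "u \<in> carrier L" "u' \<in> carrier L" "v \<in> carrier L" "v' \<in> carrier L"
    using assms grade_closed[of 0] grade_closed[of 1] by auto
  have v': "v' = \<ominus>\<^bsub>L\<^esub> u' \<oplus>\<^bsub>L\<^esub> (u \<oplus>\<^bsub>L\<^esub> v)"
    unfolding assms(5) using c by (simp add: M.r_neg1)
  have e: "u \<ominus>\<^bsub>L\<^esub> u' = v' \<ominus>\<^bsub>L\<^esub> v"
    unfolding v' using c by (simp add: a_minus_def M.a_assoc M.r_neg M.r_neg2 M.a_comm[of u])
  then have "u \<ominus>\<^bsub>L\<^esub> u' \<in> G 0 \<inter> G 1"
    using grade_minus[of 0 u u'] grade_minus[of 1 v' v] assms by simp
  then have zero: "u \<ominus>\<^bsub>L\<^esub> u' = \<zero>\<^bsub>L\<^esub>" using grade_direct by blast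
  show "u = u'" using zero c by simp
  show "v = v'" using zero[unfolded e] c by simp
qed

text \<open>The projections to the even and the odd part are linear because the sum of two decompositions is a
decomposition of the sum, and decompositions are unique.\<close>

lemma grade_projections:
  obtains p q where "linear_map K L L p" "linear_map K L L q"
    and "\<And>x. x \<in> G 0 \<Longrightarrow> p x = x" "\<And>x. x \<in> G 0 \<Longrightarrow> q x = \<zero>\<^bsub>L\<^esub>"
    and "\<And>x. x \<in> G 1 \<Longrightarrow> p x = \<zero>\<^bsub>L\<^esub>" "\<And>x. x \<in> G 1 \<Longrightarrow> q x = x"
proof -
  have "\<forall>x. \<exists>u v. x \<in> carrier L \<longrightarrow> u \<in> G 0 \<and> v \<in> G 1 \<and> x = u \<oplus>\<^bsub>L\<^esub> v"
    using grade_decompose by metis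
  then obtain p q where pq: "\<And>x. x \<in> carrier L \<Longrightarrow> p x \<in> G 0 \<and> q x \<in> G 1 \<and> x = p x \<oplus>\<^bsub>L\<^esub> q x"
    by metis
  have eq: "p x = u" "q x = v" if "u \<in> G 0" "v \<in> G 1" "x = u \<oplus>\<^bsub>L\<^esub> v" for x u v
  proof -
    have "x \<in> carrier L" using that grade_closed[of 0 u] grade_closed[of 1 v] by simp
    from pq[OF this] that show "p x = u" "q x = v"
      using grade_decompose_unique[of "p x" u "q x" v] by simp_all
  qed
  have closed: "p x \<in> carrier L" "q x \<in> carrier L" if "x \<in> carrier L" for x
    using pq[OF that] grade_closed[of 0 "p x"] grade_closed[of 1 "q x"] by auto
  have add: "p (x \<oplus>\<^bsub>L\<^esub> y) = p x \<oplus>\<^bsub>L\<^esub> p y \<and> q (x \<oplus>\<^bsub>L\<^esub> y) = q x \<oplus>\<^bsub>L\<^esub> q y"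
    if x: "x \<in> carrier L" and y: "y \<in> carrier L" for x y
  proof -
    have "x \<oplus>\<^bsub>L\<^esub> y = (p x \<oplus>\<^bsub>L\<^esub> q x) \<oplus>\<^bsub>L\<^esub> (p y \<oplus>\<^bsub>L\<^esub> q y)"
      using pq[OF x] pq[OF y] by simp
    also have "\<dots> = (p x \<oplus>\<^bsub>L\<^esub> p y) \<oplus>\<^bsub>L\<^esub> (q x \<oplus>\<^bsub>L\<^esub> q y)"
      using closed[OF x] closed[OF y] by (simp add: M.a_ac)
    finally have s: "x \<oplus>\<^bsub>L\<^esub> y = (p x \<oplus>\<^bsub>L\<^esub> p y) \<oplus>\<^bsub>L\<^esub> (q x \<oplus>\<^bsub>L\<^esub> q y)" .
    have "p x \<oplus>\<^bsub>L\<^esub> p y \<in> G 0" "q x \<oplus>\<^bsub>L\<^esub> q y \<in> G 1"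
      using pq[OF x] pq[OF y] grade_add by simp_all
    from eq[OF this s] show ?thesis by simp
  qed
  have smult: "p (a \<odot>\<^bsub>L\<^esub> x) = a \<odot>\<^bsub>L\<^esub> p x \<and> q (a \<odot>\<^bsub>L\<^esub> x) = a \<odot>\<^bsub>L\<^esub> q x"
    if a: "a \<in> carrier K" and x: "x \<in> carrier L" for a x
  proof -
    have "a \<odot>\<^bsub>L\<^esub> x = a \<odot>\<^bsub>L\<^esub> (p x \<oplus>\<^bsub>L\<^esub> q x)" using pq[OF x] by simp
    also have "\<dots> = a \<odot>\<^bsub>L\<^esub> p x \<oplus>\<^bsub>L\<^esub> a \<odot>\<^bsub>L\<^esub> q x"
      using a closed[OF x] by (simp add: smult_r_distr)
    finally have s: "a \<odot>\<^bsub>L\<^esub> x = a \<odot>\<^bsub>L\<^esub> p x \<oplus>\<^bsub>L\<^esub> a \<odot>\<^bsub>L\<^esub> q x" .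
    have "a \<odot>\<^bsub>L\<^esub> p x \<in> G 0" "a \<odot>\<^bsub>L\<^esub> q x \<in> G 1"
      using pq[OF x] a grade_smult by simp_all
    from eq[OF this s] show ?thesis by simp
  qed
  show thesis
  proof
    show "linear_map K L L p" "linear_map K L L q"
      by (rule linear_mapI[OF L L]; simp add: closed add smult)+
    show "p x = x" "q x = \<zero>\<^bsub>L\<^esub>" if "x \<in> G 0" for x
      using eq[of x "\<zero>\<^bsub>L\<^esub>" x] that grade_zero[of 1] grade_closed[of 0 x] by simp_all
    show "p x = \<zero>\<^bsub>L\<^esub>" "q x = x" if "x \<in> G 1" for x
      using eq[of "\<zero>\<^bsub>L\<^esub>" x x] that grade_zero[of 0] grade_closed[of 1 x] by simp_all
  qed
qed

lemma linear_map_graded_eqI: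
  assumes f: "linear_map K L X f" and g: "linear_map K L X g"
    and eq: "\<And>i x. i \<in> {0, 1} \<Longrightarrow> x \<in> G i \<Longrightarrow> f x = g x"
    and x: "x \<in> carrier L"
  shows "f x = g x"
proof -
  obtain u v where "u \<in> G 0" "v \<in> G 1" "x = u \<oplus>\<^bsub>L\<^esub> v" using grade_decompose[OF x] .
  then show ?thesis
    using eq[of 0 u] eq[of 1 v] grade_closed[of 0 u] grade_closed[of 1 v]
    by (simp add: linear_map_add[OF f] linear_map_add[OF g])
qed

lemma bilinear_map_graded_eqI:
  assumes b: "bilinear_map K L L X b" and c: "bilinear_map K L L X c"
    and eq: "\<And>i j x y. i \<in> {0, 1} \<Longrightarrow> j \<in> {0, 1} \<Longrightarrow> x \<in> G i \<Longrightarrow> y \<in> G j \<Longrightarrow> b x y = c x y"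
    and x: "x \<in> carrier L" and y: "y \<in> carrier L"
  shows "b x y = c x y"
proof (rule linear_map_graded_eqI[OF bilinear_map_left[OF b y] bilinear_map_left[OF c y] _ x])
  fix i u assume i: "i \<in> {0, 1}" and u: "u \<in> G i"
  note uc = grade_closed[OF i u]
  show "b u y = c u y"
    by (rule linear_map_graded_eqI[OF bilinear_map_right[OF b uc] bilinear_map_right[OF c uc] _ y])
      (rule eq[OF i _ u])
qed

lemma linear_map_graded_tensor_eqI:
  assumes f: "linear_map K LL X f" and g: "linear_map K LL X g"
    and eq: "\<And>i j x y. i \<in> {0, 1} \<Longrightarrow> j \<in> {0, 1} \<Longrightarrow> x \<in> G i \<Longrightarrow> y \<in> G j \<Longrightarrow>
      f (tens x y) = g (tens x y)"
    and t: "t \<in> carrier LL"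
  shows "f t = g t"
proof (rule tensor_product.linear_map_tensor_eqI[OF tp f g _ t])
  note b = tensor_product.bilinear_tensor[OF tp]
  show "f (tens x y) = g (tens x y)" if "x \<in> carrier L" "y \<in> carrier L" for x y
    by (rule bilinear_map_graded_eqI[OF bilinear_map_comp[OF f b] bilinear_map_comp[OF g b] eq that])
qed

lemma tensor_triple: "tensor_triple K L L L"
  by (rule tensor_triple.intro[OF L L L])

lemma linear_map_graded_cube_eqI:
  assumes f: "linear_map K (tensor_cube K L) X f" and g: "linear_map K (tensor_cube K L) X g"
    and eq: "\<And>i j l x y w. i \<in> {0, 1} \<Longrightarrow> j \<in> {0, 1} \<Longrightarrow> l \<in> {0, 1} \<Longrightarrow>
      x \<in> G i \<Longrightarrow> y \<in> G j \<Longrightarrow> w \<in> G l \<Longrightarrow>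
      f (tensor K LL L (tens x y) w) = g (tensor K LL L (tens x y) w)"
    and t: "t \<in> carrier (tensor_cube K L)"
  shows "f t = g t"
proof (rule tensor_triple.linear_map_tens_left_eqI[OF tensor_triple
      f[unfolded tensor_cube_def] g[unfolded tensor_cube_def] _ t[unfolded tensor_cube_def]])
  note b = tensor_product.bilinear_tensor[OF tensor_triple.tp_UV_W[OF tensor_triple]]
  note f' = f[unfolded tensor_cube_def] and g' = g[unfolded tensor_cube_def]
  fix x y w assume x: "x \<in> carrier L" and y: "y \<in> carrier L" and w: "w \<in> carrier L"
  have xy: "tens x y \<in> carrier LL" by (rule tensor_product.tensor_closed[OF tp x y])
  show "f (tensor K LL L (tens x y) w) = g (tensor K LL L (tens x y) w)"
  proof (rule linear_map_graded_eqI[OF linear_map_comp[OF bilinear_map_right[OF b xy] f']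
        linear_map_comp[OF bilinear_map_right[OF b xy] g'] _ w])
    fix l w assume l: "l \<in> {0, 1}" and w: "w \<in> G l"
    note bw = bilinear_map_left[OF b grade_closed[OF l w]]
    show "f (tensor K LL L (tens x y) w) = g (tensor K LL L (tens x y) w)"
      by (rule linear_map_graded_tensor_eqI[OF linear_map_comp[OF bw f'] linear_map_comp[OF bw g']
            eq[OF _ _ l _ _ w] xy])
  qed
qed

section \<open>Braidings\<close>

text \<open>The sign depends on the degrees, so the signed flip is given by a formula that is bilinear in all
of \<open>L\<close>: with \<open>p\<close> and \<open>q\<close> the projections to the even and odd part and \<open>\<sigma> = p - q\<close> the parity
automorphism, it is \<open>x \<otimes> y \<mapsto> p y \<otimes> x + q y \<otimes> \<sigma> x\<close>.\<close>

lemma super_swap: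
  obtains s where "linear_map K LL LL s"
    and "\<And>i j x y. i \<in> {0, 1} \<Longrightarrow> j \<in> {0, 1} \<Longrightarrow> x \<in> G i \<Longrightarrow> y \<in> G j \<Longrightarrow>
      s (tens x y) = \<epsilon> i j \<odot>\<^bsub>LL\<^esub> tens y x"
proof -
  interpret LL: vectorspace K LL by (rule vectorspace_tensor_space[OF L L])
  obtain p q where p: "linear_map K L L p" and q: "linear_map K L L q"
    and pq: "\<And>x. x \<in> G 0 \<Longrightarrow> p x = x" "\<And>x. x \<in> G 0 \<Longrightarrow> q x = \<zero>\<^bsub>L\<^esub>"
      "\<And>x. x \<in> G 1 \<Longrightarrow> p x = \<zero>\<^bsub>L\<^esub>" "\<And>x. x \<in> G 1 \<Longrightarrow> q x = x"
    using grade_projections by blast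
  \<comment> \<open>The subtraction is written as a scalar multiple so that the closure rules for linear maps apply.\<close>
  define \<sigma> where "\<sigma> x = p x \<oplus>\<^bsub>L\<^esub> (\<ominus>\<^bsub>K\<^esub> \<one>\<^bsub>K\<^esub>) \<odot>\<^bsub>L\<^esub> q x" for x
  have \<sigma>: "linear_map K L L \<sigma>"
    unfolding \<sigma>_def by (intro linear_map_sum linear_map_scale p q) simp
  note b = tensor_product.bilinear_tensor[OF tp]
  define c where "c x y = tens (p y) x \<oplus>\<^bsub>LL\<^esub> tens (q y) (\<sigma> x)" for x y
  have c: "bilinear_map K L L LL c"
  proof (rule bilinear_mapI)
    show "linear_map K L LL (\<lambda>x. c x y)" if "y \<in> carrier L" for y
      unfolding c_def
      by (intro linear_map_sum bilinear_map_right[OF b] linear_map_closed[OF p that]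
          linear_map_comp[OF \<sigma> bilinear_map_right[OF b]] linear_map_closed[OF q that])
    show "linear_map K L LL (c x)" if "x \<in> carrier L" for x
      unfolding c_def
      by (intro linear_map_sum linear_map_comp[OF p bilinear_map_left[OF b that]]
          linear_map_comp[OF q bilinear_map_left[OF b linear_map_closed[OF \<sigma> that]]])
  qed
  show thesis
  proof
    show "linear_map K LL LL (tensor_lift K L L LL c)"
      by (rule tensor_product.linear_map_tensor_lift[OF tp c])
    fix i j x y assume ij: "i \<in> {0, 1}" "j \<in> {0, 1}" and xy: "x \<in> G i" "y \<in> G j"
    have carr: "x \<in> carrier L" "y \<in> carrier L" using ij xy grade_closed by blast+
    have closed: "tens y x \<in> carrier LL" using carr by (intro tensor_product.tensor_closed[OF tp])
    note zl = linear_map_zero[OF bilinear_map_left[OF b]]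
    note sr = linear_map_smult[OF bilinear_map_right[OF b]]
    have "c x y = \<epsilon> i j \<odot>\<^bsub>LL\<^esub> tens y x"
      using ij xy carr closed
      by (auto simp: c_def \<sigma>_def pq zl sr koszul_sign_zero koszul_sign_one[simplified])
    then show "tensor_lift K L L LL c (tens x y) = \<epsilon> i j \<odot>\<^bsub>LL\<^esub> tens y x"
      by (simp only: tensor_product.tensor_lift_tensor[OF tp c carr])
  qed
qed

lemma super_swap_plus_bilinear:
  assumes c: "bilinear_map K L L LL c"
  obtains f where "linear_map K LL LL f"
    and "\<And>i j x y. i \<in> {0, 1} \<Longrightarrow> j \<in> {0, 1} \<Longrightarrow> x \<in> G i \<Longrightarrow> y \<in> G j \<Longrightarrow>
      f (tens x y) = c x y \<oplus>\<^bsub>LL\<^esub> \<epsilon> i j \<odot>\<^bsub>LL\<^esub> tens y x"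
proof -
  obtain s where s: "linear_map K LL LL s" "\<And>i j x y. i \<in> {0, 1} \<Longrightarrow> j \<in> {0, 1} \<Longrightarrow>
      x \<in> G i \<Longrightarrow> y \<in> G j \<Longrightarrow> s (tens x y) = \<epsilon> i j \<odot>\<^bsub>LL\<^esub> tens y x"
    using super_swap by blast
  show thesis
  proof
    show "linear_map K LL LL (\<lambda>t. tensor_lift K L L LL c t \<oplus>\<^bsub>LL\<^esub> s t)"
      by (intro linear_map_sum tensor_product.linear_map_tensor_lift[OF tp c] s(1))
    fix i j x y assume ij: "i \<in> {0, 1}" "j \<in> {0, 1}" and xy: "x \<in> G i" "y \<in> G j"
    show "tensor_lift K L L LL c (tens x y) \<oplus>\<^bsub>LL\<^esub> s (tens x y) =
        c x y \<oplus>\<^bsub>LL\<^esub> \<epsilon> i j \<odot>\<^bsub>LL\<^esub> tens y x"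
      using s(2)[OF ij xy]
        tensor_product.tensor_lift_tensor[OF tp c grade_closed[OF ij(1) xy(1)] grade_closed[OF ij(2) xy(2)]]
      by simp
  qed
qed

end

section \<open>The operator of a central element\<close>

locale central_element = lie_superalgebra K L G bracket
  for K :: "('k, 'r) ring_scheme" and L :: "('k, 'v, 'm) module_scheme"
    and G :: "nat \<Rightarrow> 'v set" and bracket :: "'v \<Rightarrow> 'v \<Rightarrow> 'v" +
  fixes z :: 'v and \<alpha> :: 'k
  assumes z_center: "z \<in> lie_center L bracket" and z_even: "z \<in> G 0"
    and \<alpha>: "\<alpha> \<in> carrier K"
begin

lemma z_closed: "z \<in> carrier L"
  using z_center by (simp add: lie_center_def)

lemma bracket_closed: "x \<in> carrier L \<Longrightarrow> y \<in> carrier L \<Longrightarrow> bracket x y \<in> carrier L"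
  by (rule linear_map_closed[OF bracket_linear_right])

lemma bracket_z_left: "x \<in> carrier L \<Longrightarrow> bracket z x = \<zero>\<^bsub>L\<^esub>"
  using z_center by (simp add: lie_center_def)

text \<open>The centre is defined by brackets with \<open>z\<close> on the left; skew symmetry moves \<open>z\<close> to the right.\<close>

lemma bracket_z_right:
  assumes "i \<in> {0, 1}" "x \<in> G i"
  shows "bracket x z = \<zero>\<^bsub>L\<^esub>"
  using super_skew[of i 0 x z] assms z_even grade_closed[OF assms] bracket_z_left
  by (simp add: koszul_sign_closed)

text \<open>Bracketing with \<open>x\<close> is a superderivation. Skew symmetry turns the super Jacobi identity into
\<open>b A - a b C - b c\<^sup>2 B = 0\<close> with the signs \<open>a\<close>, \<open>b\<close>, \<open>c\<close> of the three pairs of arguments and the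
three double brackets \<open>A\<close>, \<open>B\<close>, \<open>C\<close> of the claim. Multiplying by \<open>b\<close> isolates \<open>A\<close>, since signs
square to one.\<close>

lemma super_leibniz:
  assumes ijl: "i \<in> {0, 1}" "j \<in> {0, 1}" "l \<in> {0, 1}" and x: "x \<in> G i" and y: "y \<in> G j" and w: "w \<in> G l"
  shows "bracket x (bracket y w) =
    bracket (bracket x y) w \<oplus>\<^bsub>L\<^esub> \<epsilon> i j \<odot>\<^bsub>L\<^esub> bracket y (bracket x w)"
proof -
  define a where "a = \<epsilon> i j"
  define b where "b = \<epsilon> i l"
  define c where "c = \<epsilon> j l"
  have abc: "a \<in> carrier K" "b \<in> carrier K" "c \<in> carrier K"
    "b \<otimes>\<^bsub>K\<^esub> b = \<one>\<^bsub>K\<^esub>" "c \<otimes>\<^bsub>K\<^esub> c = \<one>\<^bsub>K\<^esub>"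
    by (simp_all add: a_def b_def c_def koszul_sign_closed koszul_sign_square)
  note carr = grade_closed[OF ijl(1) x] grade_closed[OF ijl(2) y] grade_closed[OF ijl(3) w]
  note closed = bracket_closed[OF carr(1,2)] bracket_closed[OF carr(1,3)] bracket_closed[OF carr(2,3)]
  define A where "A = bracket x (bracket y w)"
  define B where "B = bracket (bracket x y) w"
  define C where "C = bracket y (bracket x w)"
  have ABC: "A \<in> carrier L" "B \<in> carrier L" "C \<in> carrier L"
    by (simp_all add: A_def B_def C_def carr closed bracket_closed)
  have bwx: "bracket w x = \<ominus>\<^bsub>L\<^esub> (b \<odot>\<^bsub>L\<^esub> bracket x w)"
    using super_skew[OF ijl(3,1) w x] by (simp add: b_def koszul_sign_commute)
  have C: "bracket y (bracket w x) = \<ominus>\<^bsub>L\<^esub> (b \<odot>\<^bsub>L\<^esub> C)"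
    unfolding bwx C_def using abc closed carr bracket_linear_right[OF carr(2)]
    by (simp flip: smult_minus_1 add: linear_map_smult bracket_closed)
  have xy: "bracket x y \<in> G ((i + j) mod 2)" by (rule bracket_grade[OF ijl(1,2) x y])
  have ij: "(i + j) mod 2 \<in> {0, 1}" by auto
  have B: "bracket w (bracket x y) = \<ominus>\<^bsub>L\<^esub> ((b \<otimes>\<^bsub>K\<^esub> c) \<odot>\<^bsub>L\<^esub> B)"
    using super_skew[OF ijl(3) ij w xy]
    by (simp add: B_def b_def c_def koszul_sign_commute[of l] koszul_sign_add)
  have "\<zero>\<^bsub>L\<^esub> = b \<odot>\<^bsub>L\<^esub> A \<oplus>\<^bsub>L\<^esub> a \<odot>\<^bsub>L\<^esub> (\<ominus>\<^bsub>L\<^esub> (b \<odot>\<^bsub>L\<^esub> C)) \<oplus>\<^bsub>L\<^esub>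
      c \<odot>\<^bsub>L\<^esub> (\<ominus>\<^bsub>L\<^esub> ((b \<otimes>\<^bsub>K\<^esub> c) \<odot>\<^bsub>L\<^esub> B))"
    using super_jacobi[OF ijl x y w] unfolding B C
    by (simp add: A_def a_def b_def c_def koszul_sign_commute[of l])
  then have "b \<odot>\<^bsub>L\<^esub> \<zero>\<^bsub>L\<^esub> = b \<odot>\<^bsub>L\<^esub> (b \<odot>\<^bsub>L\<^esub> A \<oplus>\<^bsub>L\<^esub> a \<odot>\<^bsub>L\<^esub> (\<ominus>\<^bsub>L\<^esub> (b \<odot>\<^bsub>L\<^esub> C)) \<oplus>\<^bsub>L\<^esub>
      c \<odot>\<^bsub>L\<^esub> (\<ominus>\<^bsub>L\<^esub> ((b \<otimes>\<^bsub>K\<^esub> c) \<odot>\<^bsub>L\<^esub> B)))" by (rule arg_cong)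
  also have "\<dots> = (b \<otimes>\<^bsub>K\<^esub> b) \<odot>\<^bsub>L\<^esub> A \<ominus>\<^bsub>L\<^esub> ((c \<otimes>\<^bsub>K\<^esub> c) \<otimes>\<^bsub>K\<^esub> (b \<otimes>\<^bsub>K\<^esub> b)) \<odot>\<^bsub>L\<^esub> B \<ominus>\<^bsub>L\<^esub>
      (a \<otimes>\<^bsub>K\<^esub> (b \<otimes>\<^bsub>K\<^esub> b)) \<odot>\<^bsub>L\<^esub> C"
    using abc(1-3) ABC
    by (simp add: smult_r_distr smult_r_minus smult_assoc_simp a_minus_def R.m_ac M.a_ac)
  finally have "A \<ominus>\<^bsub>L\<^esub> (B \<oplus>\<^bsub>L\<^esub> a \<odot>\<^bsub>L\<^esub> C) = \<zero>\<^bsub>L\<^esub>"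
    using abc ABC by (simp add: a_minus_def M.minus_add M.a_assoc)
  then show ?thesis using abc ABC by (simp add: A_def B_def C_def a_def)
qed

abbreviation "phi \<equiv> is_phi K L G bracket z \<alpha>"

lemma phi_linear: "phi \<phi> \<Longrightarrow> linear_map K LL LL \<phi>"
  by (simp add: is_phi_def)

lemma phi_tensor:
  assumes "phi \<phi>" "i \<in> {0, 1}" "j \<in> {0, 1}" "x \<in> G i" "y \<in> G j"
  shows "\<phi> (tens x y) = \<alpha> \<odot>\<^bsub>LL\<^esub> tens (bracket x y) z \<oplus>\<^bsub>LL\<^esub> \<epsilon> i j \<odot>\<^bsub>LL\<^esub> tens y x"
  using assms by (auto simp: is_phi_def simp del: insert_iff)

lemma bilinear_bracket: "bilinear_map K L L L bracket"
  by (intro bilinear_mapI bracket_linear_left bracket_linear_right)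

lemma phi_unique:
  assumes "phi \<phi>" "phi \<psi>" "t \<in> carrier LL"
  shows "\<phi> t = \<psi> t"
  using assms(3)
  by (rule linear_map_graded_tensor_eqI[OF phi_linear[OF assms(1)] phi_linear[OF assms(2)], rotated])
    (simp only: phi_tensor[OF assms(1)] phi_tensor[OF assms(2)])

lemma phi_exists: "\<exists>\<phi>. phi \<phi>"
proof -
  have c: "bilinear_map K L L LL (\<lambda>x y. \<alpha> \<odot>\<^bsub>LL\<^esub> tens (bracket x y) z)"
    by (intro bilinear_map_comp[OF _ bilinear_bracket] linear_map_scale \<alpha>
        bilinear_map_left[OF tensor_product.bilinear_tensor[OF tp]] z_closed)
  obtain f where "linear_map K LL LL f"
    "\<And>i j x y. i \<in> {0, 1} \<Longrightarrow> j \<in> {0, 1} \<Longrightarrow> x \<in> G i \<Longrightarrow> y \<in> G j \<Longrightarrow>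
      f (tens x y) = \<alpha> \<odot>\<^bsub>LL\<^esub> tens (bracket x y) z \<oplus>\<^bsub>LL\<^esub> \<epsilon> i j \<odot>\<^bsub>LL\<^esub> tens y x"
    using super_swap_plus_bilinear[OF c] by blast
  then show ?thesis unfolding is_phi_def by blast
qed

text \<open>The inverse \<open>\<psi>\<close> puts \<open>z\<close> on the left of the bracket instead of on the right. Both compositions
reduce to the same cancellation: with \<open>e = \<epsilon>\<^sub>x\<^sub>y\<close> one has \<open>[y, x] = - e [x, y]\<close>, so the bracket
part of the image of \<open>e y \<otimes> x\<close> has the coefficient \<open>- \<alpha> e\<^sup>2 = - \<alpha>\<close>, while the bracket part of the first
map is flipped onto the same tensor with the coefficient \<open>\<alpha>\<close>.\<close>

lemma phi_bij:
  assumes "phi \<phi>"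
  shows "bij_betw \<phi> (carrier LL) (carrier LL)"
proof -
  interpret LL: vectorspace K LL by (rule vectorspace_tensor_space[OF L L])
  note bt = tensor_product.bilinear_tensor[OF tp] and tc = tensor_product.tensor_closed[OF tp]
  note \<phi> = phi_linear[OF assms]
  have c: "bilinear_map K L L LL (\<lambda>x y. \<alpha> \<odot>\<^bsub>LL\<^esub> tens z (bracket x y))"
    by (intro bilinear_map_comp[OF _ bilinear_bracket] linear_map_scale \<alpha> 
        bilinear_map_right[OF bt] z_closed)
  obtain \<psi> where \<psi>: "linear_map K LL LL \<psi>"
    and \<psi>_tensor: "\<And>i j x y. i \<in> {0, 1} \<Longrightarrow> j \<in> {0, 1} \<Longrightarrow> x \<in> G i \<Longrightarrow> y \<in> G j \<Longrightarrow>
      \<psi> (tens x y) = \<alpha> \<odot>\<^bsub>LL\<^esub> tens z (bracket x y) \<oplus>\<^bsub>LL\<^esub> \<epsilon> i j \<odot>\<^bsub>LL\<^esub> tens y x"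
    using super_swap_plus_bilinear[OF c] by blast
  have inverse: "\<phi> (\<psi> (tens x y)) = tens x y \<and> \<psi> (\<phi> (tens x y)) = tens x y"
    if ij: "i \<in> {0, 1}" "j \<in> {0, 1}" and xy: "x \<in> G i" "y \<in> G j" for i j x y
  proof -
    let ?u = "bracket x y"
    have u: "?u \<in> G ((i + j) mod 2)" by (rule bracket_grade[OF ij xy])
    have k: "(i + j) mod 2 \<in> {0, 1}" and zero: "0 \<in> {0::nat, 1}" by auto
    note carr = grade_closed[OF ij(1) xy(1)] grade_closed[OF ij(2) xy(2)] grade_closed[OF k u] z_closed
    define e where "e = \<epsilon> i j"
    have e: "e \<in> carrier K" "e \<otimes>\<^bsub>K\<^esub> e = \<one>\<^bsub>K\<^esub>"
      by (simp_all add: e_def koszul_sign_closed koszul_sign_square)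
    \<comment> \<open>On the tensors below the bracket part vanishes and the sign is one, as \<open>z\<close> is even.\<close>
    have \<phi>_zu: "\<phi> (tens z ?u) = tens ?u z"
      using phi_tensor[OF assms zero k z_even u] bracket_z_left[OF carr(3)] \<alpha>
        linear_map_zero[OF bilinear_map_left[OF bt z_closed]] tc[OF carr(3) z_closed]
      by (simp add: koszul_sign_zero)
    have \<psi>_uz: "\<psi> (tens ?u z) = tens z ?u"
      using \<psi>_tensor[OF k zero u z_even] bracket_z_right[OF k u] \<alpha>
        linear_map_zero[OF bilinear_map_right[OF bt z_closed]] tc[OF z_closed carr(3)]
      by (simp add: koszul_sign_zero)
    have skew: "bracket y x = \<ominus>\<^bsub>K\<^esub> e \<odot>\<^bsub>L\<^esub> ?u"
      using super_skew[OF ij(2,1) xy(2,1)] e(1) carr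
      by (simp add: e_def koszul_sign_commute smult_l_minus)
    have sl: "tens (\<ominus>\<^bsub>K\<^esub> e \<odot>\<^bsub>L\<^esub> ?u) z = \<ominus>\<^bsub>K\<^esub> e \<odot>\<^bsub>LL\<^esub> tens ?u z"
      using linear_map_smult[OF bilinear_map_left[OF bt z_closed]] e(1) carr by simp
    have sr: "tens z (\<ominus>\<^bsub>K\<^esub> e \<odot>\<^bsub>L\<^esub> ?u) = \<ominus>\<^bsub>K\<^esub> e \<odot>\<^bsub>LL\<^esub> tens z ?u"
      using linear_map_smult[OF bilinear_map_right[OF bt z_closed]] e(1) carr by simp
    have cancel: "\<alpha> \<odot>\<^bsub>LL\<^esub> t \<oplus>\<^bsub>LL\<^esub> e \<odot>\<^bsub>LL\<^esub> (\<alpha> \<odot>\<^bsub>LL\<^esub> (\<ominus>\<^bsub>K\<^esub> e \<odot>\<^bsub>LL\<^esub> t) \<oplus>\<^bsub>LL\<^esub> e \<odot>\<^bsub>LL\<^esub> s) = s"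
      if "t \<in> carrier LL" "s \<in> carrier LL" for s t
    proof -
      have "e \<odot>\<^bsub>LL\<^esub> (\<alpha> \<odot>\<^bsub>LL\<^esub> (\<ominus>\<^bsub>K\<^esub> e \<odot>\<^bsub>LL\<^esub> t) \<oplus>\<^bsub>LL\<^esub> e \<odot>\<^bsub>LL\<^esub> s) =
          (\<ominus>\<^bsub>K\<^esub> (\<alpha> \<otimes>\<^bsub>K\<^esub> (e \<otimes>\<^bsub>K\<^esub> e))) \<odot>\<^bsub>LL\<^esub> t \<oplus>\<^bsub>LL\<^esub> (e \<otimes>\<^bsub>K\<^esub> e) \<odot>\<^bsub>LL\<^esub> s"
        using that e(1) \<alpha>
        by (simp add: LL.smult_r_distr LL.smult_assoc_simp R.r_minus R.m_ac)
      also have "\<dots> = \<ominus>\<^bsub>LL\<^esub> (\<alpha> \<odot>\<^bsub>LL\<^esub> t) \<oplus>\<^bsub>LL\<^esub> s"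
        using that \<alpha> by (simp add: e(2) LL.smult_l_minus)
      finally show ?thesis using that \<alpha> by (simp add: LL.M.r_neg2)
    qed
    have "\<phi> (\<psi> (tens x y)) = \<alpha> \<odot>\<^bsub>LL\<^esub> \<phi> (tens z ?u) \<oplus>\<^bsub>LL\<^esub> e \<odot>\<^bsub>LL\<^esub> \<phi> (tens y x)"
      using \<alpha> e(1) carr
      by (simp add: \<psi>_tensor[OF ij xy] linear_map_add[OF \<phi>] linear_map_smult[OF \<phi>] tc flip: e_def)
    also have "\<dots> = tens x y"
      unfolding \<phi>_zu phi_tensor[OF assms ij(2,1) xy(2,1)] koszul_sign_commute[of j]
        e_def[symmetric] skew sl
      using carr by (intro cancel tc)
    finally have 1: "\<phi> (\<psi> (tens x y)) = tens x y" .
    have "\<psi> (\<phi> (tens x y)) = \<alpha> \<odot>\<^bsub>LL\<^esub> \<psi> (tens ?u z) \<oplus>\<^bsub>LL\<^esub> e \<odot>\<^bsub>LL\<^esub> \<psi> (tens y x)"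
      using \<alpha> e(1) carr
      by (simp add: phi_tensor[OF assms ij xy] linear_map_add[OF \<psi>] linear_map_smult[OF \<psi>] tc flip: e_def)
    also have "\<dots> = tens x y"
      unfolding \<psi>_uz \<psi>_tensor[OF ij(2,1) xy(2,1)] koszul_sign_commute[of j]
        e_def[symmetric] skew sr
      using carr by (intro cancel tc)
    finally show ?thesis using 1 by simp
  qed
  have id: "linear_map K LL LL (\<lambda>t. t)" by (rule linear_map_id) unfold_locales
  have "\<phi> (\<psi> t) = t" "\<psi> (\<phi> t) = t" if "t \<in> carrier LL" for t
    using linear_map_graded_tensor_eqI[OF linear_map_comp[OF \<psi> \<phi>] id _ that]
      linear_map_graded_tensor_eqI[OF linear_map_comp[OF \<phi> \<psi>] id _ that] inverse by blast+
  then show ?thesis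
    using linear_map_closed[OF \<phi>] linear_map_closed[OF \<psi>]
    by (intro bij_betw_byWitness[where f' = \<psi>]) auto
qed

text \<open>On homogeneous tensors both sides are expanded into the six tensors \<open>X1\<close>, ..., \<open>X6\<close>. When
\<open>R23\<close> meets an argument \<open>z\<close>, it only flips, because \<open>z\<close> is central and even
(\<open>BT_z_left\<close>, \<open>BT_z_right\<close>). After \<open>super_leibniz\<close> both expansions are the same combination of
the \<open>Xi\<close>.\<close>

lemma phi_braid:
  assumes \<phi>: "phi \<phi>" and t: "t \<in> carrier (tensor_cube K L)"
  shows "R12 K L \<phi> (R23 K L \<phi> (R12 K L \<phi> t)) = R23 K L \<phi> (R12 K L \<phi> (R23 K L \<phi> t))"
proof -
  let ?C = "tensor_cube K L"
  let ?A = "R12 K L \<phi>" and ?B = "R23 K L \<phi>"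
  note A = linear_map_R12[OF phi_linear[OF \<phi>] L] and B = linear_map_R23[OF phi_linear[OF \<phi>] L]
  interpret C: vectorspace K ?C by (rule linear_map_dom[OF A])
  note bt = tensor_product.bilinear_tensor[OF tp] and tc = tensor_product.tensor_closed[OF tp]
  define T where "T x y w = tensor K LL L (tens x y) w" for x y w
  note T_linear = tensor_triple.tens_left_linear[OF tensor_triple, folded tensor_cube_def T_def]
  have T_closed: "T x y w \<in> carrier ?C" if "x \<in> carrier L" "y \<in> carrier L" "w \<in> carrier L" for x y w
    using linear_map_closed[OF T_linear(1)] that by blast
  have AT: "?A (T x y w) =
      \<alpha> \<odot>\<^bsub>?C\<^esub> T (bracket x y) z w \<oplus>\<^bsub>?C\<^esub> \<epsilon> i j \<odot>\<^bsub>?C\<^esub> T y x w"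
    if ij: "i \<in> {0, 1}" "j \<in> {0, 1}" and xy: "x \<in> G i" "y \<in> G j" and w: "w \<in> carrier L" for i j x y w
  proof -
    note carr = grade_closed[OF ij(1) xy(1)] grade_closed[OF ij(2) xy(2)]
    note f = bilinear_map_left[OF tensor_product.bilinear_tensor[OF
          tensor_triple.tp_UV_W[OF tensor_triple]] w, folded tensor_cube_def]
    interpret LL: vectorspace K LL by (rule linear_map_dom[OF f])
    show ?thesis
      using carr \<alpha>
      by (simp add: T_def R12_tensor[OF phi_linear[OF \<phi>] L _ w] tc phi_tensor[OF \<phi> ij xy]
          linear_map_add[OF f] linear_map_smult[OF f] z_closed bracket_closed koszul_sign_closed)
  qed
  have BT: "?B (T x y w) =
      \<alpha> \<odot>\<^bsub>?C\<^esub> T x (bracket y w) z \<oplus>\<^bsub>?C\<^esub> \<epsilon> j l \<odot>\<^bsub>?C\<^esub> T x w y"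
    if jl: "j \<in> {0, 1}" "l \<in> {0, 1}" and yw: "y \<in> G j" "w \<in> G l" and x: "x \<in> carrier L" for j l x y w
  proof -
    note carr = grade_closed[OF jl(1) yw(1)] grade_closed[OF jl(2) yw(2)]
    note f = linear_map_comp[OF bilinear_map_right[OF tensor_product.bilinear_tensor[OF
          tensor_triple.tp_U_VW[OF tensor_triple]] x]
        tensor_triple.linear_map_unassoc[OF tensor_triple], folded tensor_cube_def]
    interpret LL: vectorspace K LL by (rule linear_map_dom[OF f])
    show ?thesis
      using carr \<alpha> x
      by (simp add: T_def R23_tensor[OF phi_linear[OF \<phi>] L] tc phi_tensor[OF \<phi> jl yw]
          linear_map_add[OF f] linear_map_smult[OF f] z_closed bracket_closed koszul_sign_closed
          tensor_triple.unassoc_tens_right[OF tensor_triple])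
  qed
  have zero: "0 \<in> {0::nat, 1}" by simp
  have BT_z_left: "?B (T x z w) = T x w z"
    if x: "x \<in> carrier L" and l: "l \<in> {0, 1}" and w: "w \<in> G l" for x l w
    using BT[OF zero l z_even w x] bracket_z_left[OF grade_closed[OF l w]] x grade_closed[OF l w]
      linear_map_zero[OF T_linear(2)[OF x z_closed]] T_closed z_closed \<alpha>
    by (simp add: koszul_sign_zero)
  have BT_z_right: "?B (T x y z) = T x z y"
    if x: "x \<in> carrier L" and j: "j \<in> {0, 1}" and y: "y \<in> G j" for x j y
    using BT[OF j zero y z_even x] bracket_z_right[OF j y] x grade_closed[OF j y]
      linear_map_zero[OF T_linear(2)[OF x z_closed]] T_closed z_closed \<alpha>
    by (simp add: koszul_sign_zero)
  have "?A (?B (?A (T x y w))) = ?B (?A (?B (T x y w)))"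
    if ijl: "i \<in> {0, 1}" "j \<in> {0, 1}" "l \<in> {0, 1}" and x: "x \<in> G i" and y: "y \<in> G j" and w: "w \<in> G l"
    for i j l x y w
  proof -
    define a where "a = \<epsilon> i j"
    define b where "b = \<epsilon> i l"
    define c where "c = \<epsilon> j l"
    have abc: "a \<in> carrier K" "b \<in> carrier K" "c \<in> carrier K" "a \<otimes>\<^bsub>K\<^esub> a = \<one>\<^bsub>K\<^esub>"
      by (simp_all add: a_def b_def c_def koszul_sign_closed koszul_sign_square)
    note carr = grade_closed[OF ijl(1) x] grade_closed[OF ijl(2) y] grade_closed[OF ijl(3) w] z_closed
    let ?xy = "bracket x y" and ?xw = "bracket x w" and ?yw = "bracket y w"
    have m: "k mod 2 \<in> {0, 1}" for k :: nat by auto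
    note deg = bracket_grade[OF ijl(1,2) x y] bracket_grade[OF ijl(1,3) x w]
      bracket_grade[OF ijl(2,3) y w]
    note br = bracket_closed[OF carr(1,2)] bracket_closed[OF carr(1,3)] bracket_closed[OF carr(2,3)]
    define X1 where "X1 = T (bracket ?xy w) z z"
    define X2 where "X2 = T w ?xy z"
    define X3 where "X3 = T (bracket y ?xw) z z"
    define X4 where "X4 = T ?xw y z"
    define X5 where "X5 = T ?yw z x"
    define X6 where "X6 = T w y x"
    have X: "X1 \<in> carrier ?C" "X2 \<in> carrier ?C" "X3 \<in> carrier ?C" "X4 \<in> carrier ?C"
      "X5 \<in> carrier ?C" "X6 \<in> carrier ?C"
      by (simp_all add: X1_def X2_def X3_def X4_def X5_def X6_def T_closed carr br bracket_closed)
    \<comment> \<open>The degree of a bracket is the sum of the degrees, so its sign with a third element is a product.\<close>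
    have signs: "\<epsilon> ((i + j) mod 2) l = b \<otimes>\<^bsub>K\<^esub> c" "\<epsilon> j ((i + l) mod 2) = a \<otimes>\<^bsub>K\<^esub> c"
      "\<epsilon> i ((j + l) mod 2) = a \<otimes>\<^bsub>K\<^esub> b"
      by (simp_all add: koszul_sign_add koszul_sign_commute[of _ "_ mod 2"] a_def b_def c_def)
        (simp_all add: koszul_sign_commute)
    have leib: "T (bracket x ?yw) z z = X1 \<oplus>\<^bsub>?C\<^esub> a \<odot>\<^bsub>?C\<^esub> X3"
      unfolding X1_def X3_def super_leibniz[OF ijl x y w] a_def[symmetric]
      using linear_map_add[OF T_linear(1)] linear_map_smult[OF T_linear(1)] carr br abc
      by (simp add: bracket_closed)
    have "?A (?B (?A (T x y w))) = ?A (?B (\<alpha> \<odot>\<^bsub>?C\<^esub> T ?xy z w \<oplus>\<^bsub>?C\<^esub> a \<odot>\<^bsub>?C\<^esub> T y x w))"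
      by (simp add: AT[OF ijl(1,2) x y carr(3)] a_def)
    also have "\<dots> = ?A (\<alpha> \<odot>\<^bsub>?C\<^esub> T ?xy w z \<oplus>\<^bsub>?C\<^esub>
        a \<odot>\<^bsub>?C\<^esub> (\<alpha> \<odot>\<^bsub>?C\<^esub> T y ?xw z \<oplus>\<^bsub>?C\<^esub> b \<odot>\<^bsub>?C\<^esub> T y w x))"
      using \<alpha> abc
      by (simp add: linear_map_add[OF B] linear_map_smult[OF B] T_closed carr br
          BT_z_left[OF br(1) ijl(3) w] BT[OF ijl(1,3) x w carr(2)] flip: b_def)
    also have "\<dots> = \<alpha> \<odot>\<^bsub>?C\<^esub> (\<alpha> \<odot>\<^bsub>?C\<^esub> X1 \<oplus>\<^bsub>?C\<^esub> (b \<otimes>\<^bsub>K\<^esub> c) \<odot>\<^bsub>?C\<^esub> X2) \<oplus>\<^bsub>?C\<^esub>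
        a \<odot>\<^bsub>?C\<^esub> (\<alpha> \<odot>\<^bsub>?C\<^esub> (\<alpha> \<odot>\<^bsub>?C\<^esub> X3 \<oplus>\<^bsub>?C\<^esub> (a \<otimes>\<^bsub>K\<^esub> c) \<odot>\<^bsub>?C\<^esub> X4) \<oplus>\<^bsub>?C\<^esub>
          b \<odot>\<^bsub>?C\<^esub> (\<alpha> \<odot>\<^bsub>?C\<^esub> X5 \<oplus>\<^bsub>?C\<^esub> c \<odot>\<^bsub>?C\<^esub> X6))"
      using \<alpha> abc
      by (simp add: linear_map_add[OF A] linear_map_smult[OF A] T_closed carr br
          AT[OF m ijl(3) deg(1) w carr(4)] AT[OF ijl(2) m y deg(2) carr(4)]
          AT[OF ijl(2,3) y w carr(1)] signs X1_def X2_def X3_def X4_def X5_def X6_def flip: c_def)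
    finally have lhs: "?A (?B (?A (T x y w))) = \<dots>" .
    have "?B (?A (?B (T x y w))) = ?B (?A (\<alpha> \<odot>\<^bsub>?C\<^esub> T x ?yw z \<oplus>\<^bsub>?C\<^esub> c \<odot>\<^bsub>?C\<^esub> T x w y))"
      by (simp add: BT[OF ijl(2,3) y w carr(1)] c_def)
    also have "\<dots> = ?B (\<alpha> \<odot>\<^bsub>?C\<^esub> (\<alpha> \<odot>\<^bsub>?C\<^esub> T (bracket x ?yw) z z \<oplus>\<^bsub>?C\<^esub>
          (a \<otimes>\<^bsub>K\<^esub> b) \<odot>\<^bsub>?C\<^esub> T ?yw x z) \<oplus>\<^bsub>?C\<^esub>
        c \<odot>\<^bsub>?C\<^esub> (\<alpha> \<odot>\<^bsub>?C\<^esub> T ?xw z y \<oplus>\<^bsub>?C\<^esub> b \<odot>\<^bsub>?C\<^esub> T w x y))"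
      using \<alpha> abc
      by (simp add: linear_map_add[OF A] linear_map_smult[OF A] T_closed carr br
          AT[OF ijl(1) m x deg(3) carr(4)] AT[OF ijl(1,3) x w carr(2)] signs flip: b_def)
    also have "\<dots> = \<alpha> \<odot>\<^bsub>?C\<^esub> (\<alpha> \<odot>\<^bsub>?C\<^esub> (X1 \<oplus>\<^bsub>?C\<^esub> a \<odot>\<^bsub>?C\<^esub> X3) \<oplus>\<^bsub>?C\<^esub>
          (a \<otimes>\<^bsub>K\<^esub> b) \<odot>\<^bsub>?C\<^esub> X5) \<oplus>\<^bsub>?C\<^esub>
        c \<odot>\<^bsub>?C\<^esub> (\<alpha> \<odot>\<^bsub>?C\<^esub> X4 \<oplus>\<^bsub>?C\<^esub> b \<odot>\<^bsub>?C\<^esub> (\<alpha> \<odot>\<^bsub>?C\<^esub> X2 \<oplus>\<^bsub>?C\<^esub> a \<odot>\<^bsub>?C\<^esub> X6))"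
      using \<alpha> abc
      by (simp add: linear_map_add[OF B] linear_map_smult[OF B] T_closed carr br bracket_closed
          BT_z_right[OF bracket_closed[OF carr(1) br(3)] zero z_even]
          BT_z_right[OF br(3) ijl(1) x] BT_z_left[OF br(2) ijl(2) y] BT[OF ijl(1,2) x y carr(3)]
          X2_def X4_def X5_def X6_def flip: a_def leib)
    finally have rhs: "?B (?A (?B (T x y w))) = \<dots>" .
    \<comment> \<open>Normalising products of scalars brings the two factors \<open>a\<close> next to each other, where they cancel.\<close>
    have aa: "a \<otimes>\<^bsub>K\<^esub> (a \<otimes>\<^bsub>K\<^esub> r) = r" if "r \<in> carrier K" for r
      using that abc by (simp flip: R.m_assoc)
    show ?thesis
      unfolding lhs rhs using \<alpha> abc X
      by (simp add: C.smult_r_distr C.smult_assoc_simp C.M.a_ac R.m_ac aa)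
  qed
  then show ?thesis
    using linear_map_graded_cube_eqI[OF linear_map_comp[OF linear_map_comp[OF A B] A]
        linear_map_comp[OF linear_map_comp[OF B A] B] _ t]
    unfolding T_def by blast
qed

lemma phi_yang_baxter: "phi \<phi> \<Longrightarrow> yang_baxter_operator K L \<phi>"
  by (simp add: yang_baxter_operator_def phi_linear phi_bij phi_braid)

lemma phi_exists_unique: "\<exists>!\<phi>. \<phi> \<in> extensional (carrier LL) \<and> phi \<phi>"
proof -
  obtain f where f: "phi f" using phi_exists by blast
  have r: "phi (restrict f (carrier LL))"
    unfolding is_phi_def
    using linear_map_restrict[OF phi_linear[OF f]] phi_tensor[OF f]
      tensor_product.tensor_closed[OF tp grade_closed grade_closed] by simp
  show ?thesis
  proof (rule ex1I)
    show "restrict f (carrier LL) \<in> extensional (carrier LL) \<and> phi (restrict f (carrier LL))"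
      using r by simp
    show "g = restrict f (carrier LL)" if "g \<in> extensional (carrier LL) \<and> phi g" for g
      by (rule extensionalityI[OF conjunct1[OF that] restrict_extensional])
        (simp add: phi_unique[OF conjunct2[OF that] f])
  qed
qed

end

theorem theorem5p3:
  fixes K :: "('k, 'r) ring_scheme"
    and L :: "('k, 'v, 'm) module_scheme"
    and G :: "nat \<Rightarrow> 'v set"
    and bracket :: "'v \<Rightarrow> 'v \<Rightarrow> 'v"
    and z :: 'v
    and \<alpha> :: 'k
  assumes "lie_superalgebra K L G bracket"
    and "z \<in> lie_center L bracket"
    and "z \<in> G 0"
    and "\<alpha> \<in> carrier K"
  shows "(\<exists>!\<phi>. \<phi> \<in> extensional (carrier (tensor_space K L L)) \<and> is_phi K L G bracket z \<alpha> \<phi>) \<and>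
    (\<forall>\<phi>. is_phi K L G bracket z \<alpha> \<phi> \<longrightarrow> yang_baxter_operator K L \<phi>)"
proof -
  interpret central_element K L G bracket z \<alpha>
    using assms by (intro central_element.intro central_element_axioms.intro)
  show ?thesis using phi_exists_unique phi_yang_baxter by blast
qed

end
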